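(* Fix $n \geq 3$. Let $T_1, \ldots, T_n$ be monads on a category $\mathcal{C}$, equipped with - for all $i > j$ a distributive law $\lambda_{ij} : T_i T_j \Rightarrow T_j T_i$ of $T_i$ over $T_j$, such that - for all $i > j > k$ the "Yang–Baxter" equation holds, i.e. the following two composites $T_iT_jT_k \Rightarrow T_kT_jT_i$ are equal: $$\lambda_{jk}T_i \circ T_j\lambda_{ik} \circ \lambda_{ij}T_k \;=\; T_k\lambda_{ij} \circ \lambda_{ik}T_j \circ T_i\lambda_{jk}.$$ Then for all $1 \leq i < n$ we have canonical monads $$T_1T_2\cdots T_i \quad\text{and}\quad T_{i+1}T_{i+2}\cdots T_n$$ together with a distributive law of $T_{i+1}T_{i+2}\cdots T_n$ over $T_1T_2\cdots T_i$, i.e. a distributive law $$(T_{i+1}T_{i+2}\cdots T_n)(T_1T_2\cdots T_i) \Rightarrow (T_1T_2\cdots T_i)(T_{i+1}T_{i+2}\cdots T_n),$$ given by the obvious composites of the $\lambda_{ij}$. Moreover, all the monad structures on $T_1T_2\cdots T_n$ induced by these distributive laws (for the various $i$ with $1\le i<n$) are the same.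
   Context: Juxtaposition denotes composition of functors, and whiskering of natural transformations with functors. For a monad $T$, $\eta^T$ and $\mu^T$ denote its unit and multiplication. Distributive law: for monads $S,T$ on $\mathcal{C}$, a distributive law of $S$ over $T$ is a natural transformation $\lambda : ST \Rightarrow TS$ such that (1) $\lambda\circ \eta^S T = T\eta^S$ and $\lambda\circ\mu^S T = T\mu^S\circ\lambda S\circ S\lambda$ (as maps $S^2T\Rightarrow TS$); (2) $\lambda\circ S\eta^T = \eta^T S$ and $\lambda\circ S\mu^T = \mu^T S\circ T\lambda\circ\lambda T$ (as maps $ST^2\Rightarrow TS$). Induced monad: given a distributive law $\lambda$ of $S$ over $T$, the functor $TS$ is a monad with unit $\eta^T\eta^S : 1\Rightarrow TS$ and multiplication $TSTS \xrightarrow{T\lambda S} T^2S^2 \xrightarrow{\mu^T\mu^S} TS$. This is the monad structure on $TS$ induced by $\lambda$. Canonical monads: the canonical monad structure on a block $T_aT_{a+1}\cdots T_b$ is the one obtained by iterating this construction; its unit is $\eta^{T_a}\cdots\eta^{T_b}$ and its multiplication is the composite $$T_a\cdots T_b\,T_a\cdots T_b \Rightarrow T_aT_a\,T_{a+1}T_{a+1}\cdots T_bT_b \xrightarrow{\mu^{T_a}\cdots\mu^{T_b}} T_a\cdots T_b,$$ where the first map is a composite of whiskered instances of the $\lambda_{pq}$, each replacing an adjacent pair $T_pT_q$ with $p>q$ by $T_qT_p$. Obvious composite: the map $(T_{i+1}\cdots T_n)(T_1\cdots T_i)\Rightarrow(T_1\cdots T_i)(T_{i+1}\cdots T_n)$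 is the composite of whiskered instances of the $\lambda_{pq}$ ($p>i\geq q$) in which each $T_p$ with $p>i$ is moved past each $T_q$ with $q\le i$ exactly once. For both kinds of composite, different choices of order of the swaps give the same natural transformation, by naturality. *)

theory Defs
  imports Main
begin

section \<open>Categories and endofunctors\<close>

text \<open>Objects and arrows form carrier sets inside the types \<open>'o\<close> and \<open>'m\<close>, so equalities of functors
  and of natural transformations below are always understood on these carriers.
  \<open>comp C g f\<close> is \<open>g\<close> after \<open>f\<close>.\<close>

record ('o, 'm) cat =
  obj :: "'o set"
  arr :: "'m set"
  src :: "'m \<Rightarrow> 'o"
  tgt :: "'m \<Rightarrow> 'o"
  ide :: "'o \<Rightarrow> 'm"
  comp :: "'m \<Rightarrow> 'm \<Rightarrow> 'm"

definition hom :: "('o, 'm) cat \<Rightarrow> 'o \<Rightarrow> 'o \<Rightarrow> 'm set" where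
  "hom C x y = {f \<in> arr C. src C f = x \<and> tgt C f = y}"

locale category =
  fixes C :: "('o, 'm) cat"
  assumes src_obj: "f \<in> arr C \<Longrightarrow> src C f \<in> obj C"
    and tgt_obj: "f \<in> arr C \<Longrightarrow> tgt C f \<in> obj C"
    and ide_hom: "x \<in> obj C \<Longrightarrow> ide C x \<in> hom C x x"
    and comp_hom: "f \<in> hom C x y \<Longrightarrow> g \<in> hom C y z \<Longrightarrow> comp C g f \<in> hom C x z"
    and comp_ide_left: "f \<in> hom C x y \<Longrightarrow> comp C (ide C y) f = f"
    and comp_ide_right: "f \<in> hom C x y \<Longrightarrow> comp C f (ide C x) = f"
    and comp_assoc: "f \<in> hom C w x \<Longrightarrow> g \<in> hom C x y \<Longrightarrow> h \<in> hom C y z \<Longrightarrow>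
      comp C (comp C h g) f = comp C h (comp C g f)"

record ('o, 'm) endo =
  on_obj :: "'o \<Rightarrow> 'o"
  on_arr :: "'m \<Rightarrow> 'm"

definition endofunctor :: "('o, 'm) cat \<Rightarrow> ('o, 'm) endo \<Rightarrow> bool" where
  "endofunctor C F \<longleftrightarrow>
    (\<forall>x\<in>obj C. on_obj F x \<in> obj C) \<and>
    (\<forall>x\<in>obj C. \<forall>y\<in>obj C. \<forall>f\<in>hom C x y. on_arr F f \<in> hom C (on_obj F x) (on_obj F y)) \<and>
    (\<forall>x\<in>obj C. on_arr F (ide C x) = ide C (on_obj F x)) \<and>
    (\<forall>x\<in>obj C. \<forall>y\<in>obj C. \<forall>z\<in>obj C. \<forall>f\<in>hom C x y. \<forall>g\<in>hom C y z.
      on_arr F (comp C g f) = comp C (on_arr F g) (on_arr F f))"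

definition id_endo :: "('o, 'm) endo" where
  "id_endo = \<lparr>on_obj = (\<lambda>x. x), on_arr = (\<lambda>f. f)\<rparr>"

definition endo_comp :: "('o, 'm) endo \<Rightarrow> ('o, 'm) endo \<Rightarrow> ('o, 'm) endo" (infixr \<open>\<odot>\<close> 75) where
  "F \<odot> G = \<lparr>on_obj = on_obj F \<circ> on_obj G, on_arr = on_arr F \<circ> on_arr G\<rparr>"

definition endo_eq :: "('o, 'm) cat \<Rightarrow> ('o, 'm) endo \<Rightarrow> ('o, 'm) endo \<Rightarrow> bool" where
  "endo_eq C F G \<longleftrightarrow>
    (\<forall>x\<in>obj C. on_obj F x = on_obj G x) \<and> (\<forall>f\<in>arr C. on_arr F f = on_arr G f)"

section \<open>Natural transformations\<close>

text \<open>A natural transformation is represented by its family of components.\<close>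

definition natural ::
  "('o, 'm) cat \<Rightarrow> ('o, 'm) endo \<Rightarrow> ('o, 'm) endo \<Rightarrow> ('o \<Rightarrow> 'm) \<Rightarrow> bool" where
  "natural C F G \<alpha> \<longleftrightarrow>
    (\<forall>x\<in>obj C. \<alpha> x \<in> hom C (on_obj F x) (on_obj G x)) \<and>
    (\<forall>x\<in>obj C. \<forall>y\<in>obj C. \<forall>f\<in>hom C x y.
      comp C (\<alpha> y) (on_arr F f) = comp C (on_arr G f) (\<alpha> x))"

definition nat_eq :: "('o, 'm) cat \<Rightarrow> ('o \<Rightarrow> 'm) \<Rightarrow> ('o \<Rightarrow> 'm) \<Rightarrow> bool" where
  "nat_eq C \<alpha> \<beta> \<longleftrightarrow> (\<forall>x\<in>obj C. \<alpha> x = \<beta> x)"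

definition vcomp :: "('o, 'm) cat \<Rightarrow> ('o \<Rightarrow> 'm) \<Rightarrow> ('o \<Rightarrow> 'm) \<Rightarrow> ('o \<Rightarrow> 'm)" where
  "vcomp C \<beta> \<alpha> = (\<lambda>x. comp C (\<beta> x) (\<alpha> x))"

text \<open>\<open>F \<rhd> \<alpha>\<close> is the whiskering written \<open>F\<alpha>\<close> by juxtaposition, and \<open>\<alpha> \<lhd> F\<close> is \<open>\<alpha>F\<close>.\<close>

definition whisker_left :: "('o, 'm) endo \<Rightarrow> ('o \<Rightarrow> 'm) \<Rightarrow> ('o \<Rightarrow> 'm)" (infixr \<open>\<rhd>\<close> 73) where
  "F \<rhd> \<alpha> = (\<lambda>x. on_arr F (\<alpha> x))"

definition whisker_right :: "('o \<Rightarrow> 'm) \<Rightarrow> ('o, 'm) endo \<Rightarrow> ('o \<Rightarrow> 'm)" (infixl \<open>\<lhd>\<close> 74) where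
  "\<alpha> \<lhd> F = (\<lambda>x. \<alpha> (on_obj F x))"

text \<open>The horizontal composite \<open>\<alpha>\<beta> : FF' \<Rightarrow> GG'\<close> of \<open>\<alpha> : F \<Rightarrow> G\<close> and \<open>\<beta> : F' \<Rightarrow> G'\<close>,
  written as \<open>\<alpha>G' \<circ> F\<beta>\<close>; the functors \<open>F\<close> and \<open>G'\<close> have to be supplied since families of
  components do not carry them.\<close>

definition hcomp ::
  "('o, 'm) cat \<Rightarrow> ('o, 'm) endo \<Rightarrow> ('o, 'm) endo \<Rightarrow> ('o \<Rightarrow> 'm) \<Rightarrow> ('o \<Rightarrow> 'm) \<Rightarrow> ('o \<Rightarrow> 'm)" where
  "hcomp C F G' \<alpha> \<beta> = vcomp C (\<alpha> \<lhd> G') (F \<rhd> \<beta>)"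

section \<open>Monads and distributive laws\<close>

record ('o, 'm) monad =
  endo :: "('o, 'm) endo"
  unit :: "'o \<Rightarrow> 'm"
  mult :: "'o \<Rightarrow> 'm"

definition is_monad :: "('o, 'm) cat \<Rightarrow> ('o, 'm) monad \<Rightarrow> bool" where
  "is_monad C M \<longleftrightarrow>
    endofunctor C (endo M) \<and>
    natural C id_endo (endo M) (unit M) \<and>
    natural C (endo M \<odot> endo M) (endo M) (mult M) \<and>
    nat_eq C (vcomp C (mult M) (unit M \<lhd> endo M)) (\<lambda>x. ide C (on_obj (endo M) x)) \<and>
    nat_eq C (vcomp C (mult M) (endo M \<rhd> unit M)) (\<lambda>x. ide C (on_obj (endo M) x)) \<and>
    nat_eq C (vcomp C (mult M) (mult M \<lhd> endo M)) (vcomp C (mult M) (endo M \<rhd> mult M))"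

definition monad_eq :: "('o, 'm) cat \<Rightarrow> ('o, 'm) monad \<Rightarrow> ('o, 'm) monad \<Rightarrow> bool" where
  "monad_eq C M N \<longleftrightarrow>
    endo_eq C (endo M) (endo N) \<and> nat_eq C (unit M) (unit N) \<and> nat_eq C (mult M) (mult N)"

text \<open>\<open>distributive_law C S T l\<close>: \<open>l : ST \<Rightarrow> TS\<close> is a distributive law of \<open>S\<close> over \<open>T\<close>.\<close>

definition distributive_law ::
  "('o, 'm) cat \<Rightarrow> ('o, 'm) monad \<Rightarrow> ('o, 'm) monad \<Rightarrow> ('o \<Rightarrow> 'm) \<Rightarrow> bool" where
  "distributive_law C S T l \<longleftrightarrow>
    is_monad C S \<and> is_monad C T \<and>
    natural C (endo S \<odot> endo T) (endo T \<odot> endo S) l \<and>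
    nat_eq C (vcomp C l (unit S \<lhd> endo T)) (endo T \<rhd> unit S) \<and>
    nat_eq C (vcomp C l (mult S \<lhd> endo T))
      (vcomp C (endo T \<rhd> mult S) (vcomp C (l \<lhd> endo S) (endo S \<rhd> l))) \<and>
    nat_eq C (vcomp C l (endo S \<rhd> unit T)) (unit T \<lhd> endo S) \<and>
    nat_eq C (vcomp C l (endo S \<rhd> mult T))
      (vcomp C (mult T \<lhd> endo S) (vcomp C (endo T \<rhd> l) (l \<lhd> endo T)))"

text \<open>The monad structure on \<open>TS\<close> induced by \<open>l : ST \<Rightarrow> TS\<close>.\<close>

definition induced_monad ::
  "('o, 'm) cat \<Rightarrow> ('o, 'm) monad \<Rightarrow> ('o, 'm) monad \<Rightarrow> ('o \<Rightarrow> 'm) \<Rightarrow> ('o, 'm) monad" where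
  "induced_monad C S T l =
    \<lparr>endo = endo T \<odot> endo S,
     unit = hcomp C id_endo (endo S) (unit T) (unit S),
     mult = vcomp C (hcomp C (endo T \<odot> endo T) (endo S) (mult T) (mult S))
              (endo T \<rhd> l \<lhd> endo S)\<rparr>"

section \<open>Composites of the given distributive laws\<close>

text \<open>A word \<open>[p\<^sub>1, \<dots>, p\<^sub>k]\<close> of indices stands for the functor \<open>T\<^bsub>p\<^sub>1\<^esub> \<dots> T\<^bsub>p\<^sub>k\<^esub>\<close>. The law
  \<open>lam p q : T\<^sub>p T\<^sub>q \<Rightarrow> T\<^sub>q T\<^sub>p\<close> is only meaningful for \<open>p > q\<close>.\<close>

fun word_endo :: "(nat \<Rightarrow> ('o, 'm) monad) \<Rightarrow> nat list \<Rightarrow> ('o, 'm) endo" where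
  "word_endo T [] = id_endo"
| "word_endo T (p # w) = endo (T p) \<odot> word_endo T w"

fun word_unit ::
  "('o, 'm) cat \<Rightarrow> (nat \<Rightarrow> ('o, 'm) monad) \<Rightarrow> nat list \<Rightarrow> ('o \<Rightarrow> 'm)" where
  "word_unit C T [] = ide C"
| "word_unit C T (p # w) = hcomp C id_endo (word_endo T w) (unit (T p)) (word_unit C T w)"

text \<open>\<open>\<mu>\<^bsub>p\<^sub>1\<^esub> \<dots> \<mu>\<^bsub>p\<^sub>k\<^esub> : T\<^bsub>p\<^sub>1\<^esub>T\<^bsub>p\<^sub>1\<^esub> \<dots> T\<^bsub>p\<^sub>k\<^esub>T\<^bsub>p\<^sub>k\<^esub> \<Rightarrow> T\<^bsub>p\<^sub>1\<^esub> \<dots> T\<^bsub>p\<^sub>k\<^esub>\<close>\<close>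

fun word_mult ::
  "('o, 'm) cat \<Rightarrow> (nat \<Rightarrow> ('o, 'm) monad) \<Rightarrow> nat list \<Rightarrow> ('o \<Rightarrow> 'm)" where
  "word_mult C T [] = ide C"
| "word_mult C T (p # w) =
    hcomp C (endo (T p) \<odot> endo (T p)) (word_endo T w) (mult (T p)) (word_mult C T w)"

definition double :: "nat list \<Rightarrow> nat list" where
  "double w = concat (map (\<lambda>p. [p, p]) w)"

text \<open>\<open>swap_composite C T lam u v \<alpha>\<close>: the transformation \<open>\<alpha>\<close> from the word \<open>u\<close> to the word \<open>v\<close> is a
  composite of whiskered laws, each replacing an adjacent pair \<open>T\<^sub>p T\<^sub>q\<close> with \<open>p > q\<close> by
  \<open>T\<^sub>q T\<^sub>p\<close>. The order of the swaps is left open.\<close>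

inductive swap_composite ::
  "('o, 'm) cat \<Rightarrow> (nat \<Rightarrow> ('o, 'm) monad) \<Rightarrow> (nat \<Rightarrow> nat \<Rightarrow> 'o \<Rightarrow> 'm) \<Rightarrow>
    nat list \<Rightarrow> nat list \<Rightarrow> ('o \<Rightarrow> 'm) \<Rightarrow> bool"
  for C T lam where
  refl: "swap_composite C T lam w w (\<lambda>x. ide C (on_obj (word_endo T w) x))"
| step: "p > q \<Longrightarrow> swap_composite C T lam (u @ [q, p] @ v) w \<alpha> \<Longrightarrow>
    swap_composite C T lam (u @ [p, q] @ v) w
      (vcomp C \<alpha> (word_endo T u \<rhd> lam p q \<lhd> word_endo T v))"

abbreviation block :: "nat \<Rightarrow> nat \<Rightarrow> nat list" where
  "block a b \<equiv> [a..<Suc b]"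

text \<open>The obvious composites
  \<open>(T\<^bsub>j+1\<^esub> \<dots> T\<^sub>b)(T\<^sub>a \<dots> T\<^sub>j) \<Rightarrow> (T\<^sub>a \<dots> T\<^sub>j)(T\<^bsub>j+1\<^esub> \<dots> T\<^sub>b)\<close>. Since every swap removes exactly
  one inversion and the letters are distinct, the swaps occurring are exactly those of each \<open>p > j\<close>
  past each \<open>q \<le> j\<close>, each exactly once.\<close>

definition obvious_composite ::
  "('o, 'm) cat \<Rightarrow> (nat \<Rightarrow> ('o, 'm) monad) \<Rightarrow> (nat \<Rightarrow> nat \<Rightarrow> 'o \<Rightarrow> 'm) \<Rightarrow>
    nat \<Rightarrow> nat \<Rightarrow> nat \<Rightarrow> ('o \<Rightarrow> 'm) \<Rightarrow> bool" where
  "obvious_composite C T lam a j b l \<longleftrightarrow>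
    swap_composite C T lam (block (j + 1) b @ block a j) (block a j @ block (j + 1) b) l"

text \<open>\<open>canonical_monad C T lam a b M\<close>: \<open>M\<close> is obtained on \<open>T\<^sub>a \<dots> T\<^sub>b\<close> by iterating the induced monad
  construction. Neither the bracketing nor the order of the swaps is prescribed.\<close>

inductive canonical_monad ::
  "('o, 'm) cat \<Rightarrow> (nat \<Rightarrow> ('o, 'm) monad) \<Rightarrow> (nat \<Rightarrow> nat \<Rightarrow> 'o \<Rightarrow> 'm) \<Rightarrow>
    nat \<Rightarrow> nat \<Rightarrow> ('o, 'm) monad \<Rightarrow> bool"
  for C T lam where
  single: "canonical_monad C T lam a a (T a)"
| split: "a \<le> j \<Longrightarrow> j < b \<Longrightarrow> canonical_monad C T lam a j M \<Longrightarrow>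
    canonical_monad C T lam (j + 1) b N \<Longrightarrow> obvious_composite C T lam a j b l \<Longrightarrow>
    canonical_monad C T lam a b (induced_monad C N M l)"

text \<open>The explicit description of the canonical structure on \<open>T\<^sub>a \<dots> T\<^sub>b\<close>: its unit is
  \<open>\<eta>\<^sub>a \<dots> \<eta>\<^sub>b\<close>, and its multiplication is
  \<open>T\<^sub>a \<dots> T\<^sub>b T\<^sub>a \<dots> T\<^sub>b \<Rightarrow> T\<^sub>aT\<^sub>a \<dots> T\<^sub>bT\<^sub>b \<Rightarrow> T\<^sub>a \<dots> T\<^sub>b\<close>, for any choice of order of the swaps in the
  first map.\<close>

definition canonical_form ::
  "('o, 'm) cat \<Rightarrow> (nat \<Rightarrow> ('o, 'm) monad) \<Rightarrow> (nat \<Rightarrow> nat \<Rightarrow> 'o \<Rightarrow> 'm) \<Rightarrow>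
    nat \<Rightarrow> nat \<Rightarrow> ('o, 'm) monad \<Rightarrow> bool" where
  "canonical_form C T lam a b M \<longleftrightarrow>
    endo_eq C (endo M) (word_endo T (block a b)) \<and>
    nat_eq C (unit M) (word_unit C T (block a b)) \<and>
    (\<exists>s. swap_composite C T lam (block a b @ block a b) (double (block a b)) s) \<and>
    (\<forall>s. swap_composite C T lam (block a b @ block a b) (double (block a b)) s \<longrightarrow>
      nat_eq C (mult M) (vcomp C (word_mult C T (block a b)) s))"

definition yang_baxter ::
  "('o, 'm) cat \<Rightarrow> (nat \<Rightarrow> ('o, 'm) monad) \<Rightarrow> (nat \<Rightarrow> nat \<Rightarrow> 'o \<Rightarrow> 'm) \<Rightarrow>
    nat \<Rightarrow> nat \<Rightarrow> nat \<Rightarrow> bool" where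
  "yang_baxter C T lam i j k \<longleftrightarrow>
    nat_eq C
      (vcomp C (lam j k \<lhd> endo (T i)) (vcomp C (endo (T j) \<rhd> lam i k) (lam i j \<lhd> endo (T k))))
      (vcomp C (endo (T k) \<rhd> lam i j) (vcomp C (lam i k \<lhd> endo (T j)) (endo (T i) \<rhd> lam j k)))"

end

theory Submission
  imports "HOL-Library.Multiset" Defs (* in this order, since Multiset has a constant mult too *)
begin

text \<open>Everything follows from a coherence theorem. Consider words of indices under the moves
  \<open>pq \<rightarrow> qp\<close> for \<open>p > q\<close> (the laws \<open>\<lambda>\<close>), \<open>pp \<rightarrow> p\<close> (the multiplications) and \<open>[] \<rightarrow> p\<close> (the units).
  Then any two composites of whiskered moves from \<open>u\<close> to the same strictly increasing word \<open>w\<close> are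
  equal. Both sides of each axiom of a monad, of each axiom of a distributive law and of each equality
  between canonical structures are such composites.

  Without the units the moves terminate, and the critical pairs \<open>pqr\<close>, \<open>ppr\<close>, \<open>prr\<close>, \<open>ppp\<close> are
  resolved by Yang--Baxter, the two multiplication axioms of a distributive law and associativity. So
  a word has only one composite of such moves to its normal form, which consists of its letters in
  increasing order. Inserting a unit \<open>p\<close> into a word in which \<open>p\<close> occurs does not affect the composite
  to the normal form. Hence any composite \<open>u \<rightarrow> w\<close> equals the one that first inserts all letters of
  \<open>w\<close> in front of \<open>u\<close> and then normalizes.\<close>

section \<open>Whiskering and sorting words\<close>

lemma whisker_left_comp: "(F \<odot> G) \<rhd> \<alpha> = F \<rhd> (G \<rhd> \<alpha>)"
  by (simp add: whisker_left_def endo_comp_def)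

lemma whisker_right_comp: "\<alpha> \<lhd> (F \<odot> G) = \<alpha> \<lhd> F \<lhd> G"
  by (simp add: whisker_right_def endo_comp_def)

lemma whisker_left_right: "(F \<rhd> \<alpha>) \<lhd> G = F \<rhd> \<alpha> \<lhd> G"
  by (simp add: whisker_left_def whisker_right_def)

lemma whisker_left_id [simp]: "id_endo \<rhd> \<alpha> = \<alpha>"
  by (simp add: whisker_left_def id_endo_def)

lemma whisker_right_id [simp]: "\<alpha> \<lhd> id_endo = \<alpha>"
  by (simp add: whisker_right_def id_endo_def)

lemma endo_comp_id_left [simp]: "id_endo \<odot> F = (F :: ('o, 'm) endo)"
  by (cases F) (simp add: endo_comp_def id_endo_def o_def)

lemma endo_comp_id_right [simp]: "F \<odot> id_endo = (F :: ('o, 'm) endo)"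
  by (cases F) (simp add: endo_comp_def id_endo_def o_def)

lemma endo_comp_assoc: "(F \<odot> G) \<odot> H = F \<odot> (G \<odot> H)"
  by (simp add: endo_comp_def o_assoc)

lemma on_obj_endo_comp [simp]: "on_obj (F \<odot> G) x = on_obj F (on_obj G x)"
  by (simp add: endo_comp_def)

lemma on_arr_endo_comp [simp]: "on_arr (F \<odot> G) f = on_arr F (on_arr G f)"
  by (simp add: endo_comp_def)

lemma on_obj_id_endo [simp]: "on_obj id_endo x = x"
  by (simp add: id_endo_def)

lemma on_arr_id_endo [simp]: "on_arr id_endo f = f"
  by (simp add: id_endo_def)

lemma word_endo_append: "word_endo T (u @ v) = word_endo T u \<odot> word_endo T v"
  by (induction u) (simp_all add: endo_comp_assoc)

lemma endofunctor_id_endo: "endofunctor C id_endo"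
  by (simp add: endofunctor_def)

lemma endofunctor_endo_comp:
  assumes "endofunctor C F" and "endofunctor C G"
  shows "endofunctor C (F \<odot> G)"
  using assms unfolding endofunctor_def on_obj_endo_comp on_arr_endo_comp
  by (intro conjI ballI) (metis (no_types, lifting))+

lemma (in category) hom_obj:
  assumes "f \<in> hom C x y" shows "x \<in> obj C" and "y \<in> obj C"
  using assms src_obj tgt_obj by (auto simp: hom_def)

lemma nat_eq_refl [simp]: "nat_eq C \<alpha> \<alpha>"
  by (simp add: nat_eq_def)

lemma nat_eq_sym: "nat_eq C \<alpha> \<beta> \<Longrightarrow> nat_eq C \<beta> \<alpha>"
  by (simp add: nat_eq_def)

lemma nat_eq_trans [trans]: "nat_eq C \<alpha> \<beta> \<Longrightarrow> nat_eq C \<beta> \<gamma> \<Longrightarrow> nat_eq C \<alpha> \<gamma>"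
  by (simp add: nat_eq_def)

lemma vcomp_cong: "nat_eq C \<beta> \<beta>' \<Longrightarrow> nat_eq C \<alpha> \<alpha>' \<Longrightarrow> nat_eq C (vcomp C \<beta> \<alpha>) (vcomp C \<beta>' \<alpha>')"
  by (simp add: nat_eq_def vcomp_def)

text \<open>By transitivity, sortedness can be tested on adjacent letters. Used with
  \<open>\<le>\<close> for sorting by swaps and with \<open><\<close> for finding a redex.\<close>

lemma not_sorted_wrt_adjacent:
  assumes "transp P" and "\<not> sorted_wrt P u"
  obtains x p q y where "u = x @ [p, q] @ y" and "\<not> P p q"
proof -
  have "\<exists>x p q y. u = x @ [p, q] @ y \<and> \<not> P p q"
    using assms(2)
  proof (induction u)
    case (Cons p u)
    show ?case
    proof (cases "sorted_wrt P u")
      case True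
      then obtain q u' where "u = q # u'" "\<not> P p q"
        using Cons.prems assms(1) by (cases u) (auto dest: transpD)
      then show ?thesis
        by (metis append_Cons append_Nil)
    next
      case False
      then show ?thesis
        using Cons.IH by (metis append_Cons)
    qed
  qed simp
  then show ?thesis
    using that by blast
qed

text \<open>Locates an inserted letter p relative to a redex ac, as needed in
  \<open>unit_absorption\<close>: to the right of it, its second letter, its first letter, to the
  left of it.\<close>

lemma adjacent_pair_cases:
  assumes "x @ [p] @ y = x' @ [a, c] @ y'"
  obtains t where "x = x' @ [a, c] @ t" and "y' = t @ [p] @ y"
  | "x = x' @ [a]" and "c = p" and "y' = y"
  | "x = x'" and "a = p" and "y = [c] @ y'"
  | t where "x' = x @ [p] @ t" and "y = t @ [a, c] @ y'"
proof -
  have "(\<exists>t. x = x' @ [a, c] @ t \<and> y' = t @ [p] @ y) \<or> x = x' @ [a] \<and> c = p \<and> y' = y \<or>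
      x = x' \<and> a = p \<and> y = [c] @ y' \<or> (\<exists>t. x' = x @ [p] @ t \<and> y = t @ [a, c] @ y')"
    using assms
  proof (induction x arbitrary: x')
    case Nil
    then show ?case by (cases x') auto
  next
    case (Cons b x)
    note prems = Cons.prems and IH = Cons.IH
    show ?case
    proof (cases x')
      case Nil
      then show ?thesis
        using prems by (cases x) auto
    next
      case (Cons b' z)
      then show ?thesis
        using prems IH[of z] by auto
    qed
  qed
  then show ?thesis
    using that by blast
qed

text \<open>Bubble sort: swapping a descent keeps the length and makes the word lexicographically
  smaller, so induction along \<open>lenlex\<close> applies.\<close>

lemma swap_composite_sort: "\<exists>\<alpha>. swap_composite C T lam u (sort u) \<alpha>"
  using wf_lenlex[OF wf_less_than]
proof (induction u rule: wf_induct_rule)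
  case (less u)
  show ?case
  proof (cases "sorted u")
    case True
    then show ?thesis
      using swap_composite.refl[of C T lam u] sort_key_id_if_sorted[of "\<lambda>x. x" u] by auto
  next
    case False
    obtain x p q y where u: "u = x @ [p, q] @ y" and "\<not> p \<le> q"
      by (rule not_sorted_wrt_adjacent[OF transp_on_le False])
    then have "q < p"
      by simp
    let ?v = "x @ [q, p] @ y"
    have "(?v, u) \<in> lenlex less_than"
      using u \<open>q < p\<close> by (auto simp: lenlex_conv lex_append_leftI)
    moreover have "sort ?v = sort u"
      by (rule properties_for_sort) (simp_all add: u)
    ultimately obtain \<alpha> where "swap_composite C T lam ?v (sort u) \<alpha>"
      using less.IH by metis
    then show ?thesis
      using swap_composite.step[OF \<open>q < p\<close>] u by blast
  qed
qed

section \<open>Existence of the obvious composites and of the canonical monads\<close>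

lemma block_append: "a \<le> j + 1 \<Longrightarrow> j \<le> b \<Longrightarrow> block a j @ block (j + 1) b = block a b"
  using upt_add_eq_append[of a "j + 1" "b - j"] by simp

text \<open>The target is the sorted rearrangement of the source, so sorting by swaps provides the
  composite.\<close>

lemma obvious_composite_exists:
  assumes "a \<le> j + 1" and "j \<le> b"
  shows "\<exists>l. obvious_composite C T lam a j b l"
proof -
  have "sort (block (j + 1) b @ block a j) = block a b"
  proof (rule properties_for_sort)
    show "mset (block a b) = mset (block (j + 1) b @ block a j)"
      unfolding block_append[OF assms, symmetric] by (simp del: upt_Suc)
  qed (simp del: upt_Suc)
  then show ?thesis
    using swap_composite_sort[of C T lam "block (j + 1) b @ block a j"]
    unfolding obvious_composite_def block_append[OF assms] by metis
qed

text \<open>The witness is bracketed to the left: the monads are adjoined one at a time on the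
  right.\<close>

lemma canonical_monad_exists: "a \<le> b \<Longrightarrow> \<exists>M. canonical_monad C T lam a b M"
proof (induction b rule: dec_induct)
  case base
  show ?case
    using canonical_monad.single by blast
next
  case (step b)
  then obtain M where M: "canonical_monad C T lam a b M"
    by blast
  obtain l where "obvious_composite C T lam a b (b + 1) l"
    using obvious_composite_exists[of a b "b + 1" C T lam] step.hyps by auto
  then have "canonical_monad C T lam a (b + 1) (induced_monad C (T (b + 1)) M l)"
    using canonical_monad.split[OF _ _ M canonical_monad.single] step.hyps by simp
  then show ?case
    by auto
qed

section \<open>Words with every letter doubled\<close>

lemma double_simps [simp]: "double [] = []" "double (p # w) = p # p # double w"
  by (simp_all add: double_def)

lemma set_double [simp]: "set (double w) = set w"
  by (induction w) auto

lemma sorted_double: "sorted w \<Longrightarrow> sorted (double w)"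
  by (induction w) auto

lemma mset_double: "mset (double w) = mset (w @ w)"
  by (induction w) auto

section \<open>Transformations between words\<close>

text \<open>The assumptions speak only of indices in \<open>I\<close>, so words are restricted to
  letters from \<open>I\<close> throughout. The theorem takes \<open>I\<close> to be {1..n}.\<close>

locale distributive_series = category C
  for C :: "('o, 'm) cat" +
  fixes T :: "nat \<Rightarrow> ('o, 'm) monad"
    and lam :: "nat \<Rightarrow> nat \<Rightarrow> 'o \<Rightarrow> 'm"
    and I :: "nat set"
  assumes monad: "i \<in> I \<Longrightarrow> is_monad C (T i)"
    and law: "i \<in> I \<Longrightarrow> j \<in> I \<Longrightarrow> j < i \<Longrightarrow> distributive_law C (T i) (T j) (lam i j)"
    and yb: "i \<in> I \<Longrightarrow> j \<in> I \<Longrightarrow> k \<in> I \<Longrightarrow> k < j \<Longrightarrow> j < i \<Longrightarrow> yang_baxter C T lam i j k"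
begin

abbreviation equiv_trans (infix \<open>\<approx>\<close> 50) where "\<alpha> \<approx> \<beta> \<equiv> nat_eq C \<alpha> \<beta>"

abbreviation vcomp_infix (infixr \<open>\<bullet>\<close> 71) where "\<beta> \<bullet> \<alpha> \<equiv> vcomp C \<beta> \<alpha>"

abbreviation W where "W u \<equiv> word_endo T u"

abbreviation id_trans where "id_trans u \<equiv> (\<lambda>x. ide C (on_obj (W u) x))"

text \<open>A typing judgement for families of components. The conditions on letters make both words
  denote endofunctors, so that vertical composites and whiskerings are well typed.\<close>

definition trans_on where
  "trans_on u v \<alpha> \<longleftrightarrow> set u \<subseteq> I \<and> set v \<subseteq> I \<and> natural C (W u) (W v) \<alpha>"

lemma endofunctor_word: "set u \<subseteq> I \<Longrightarrow> endofunctor C (W u)"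
proof (induction u)
  case (Cons p u)
  then show ?case
    using monad[of p] by (auto simp: is_monad_def intro!: endofunctor_endo_comp)
qed (simp add: endofunctor_id_endo)

lemma word_obj: "set u \<subseteq> I \<Longrightarrow> x \<in> obj C \<Longrightarrow> on_obj (W u) x \<in> obj C"
  using endofunctor_word[of u] by (simp add: endofunctor_def)

lemma word_hom:
  "set u \<subseteq> I \<Longrightarrow> f \<in> hom C x y \<Longrightarrow> on_arr (W u) f \<in> hom C (on_obj (W u) x) (on_obj (W u) y)"
  using endofunctor_word[of u] hom_obj[of f x y] by (simp add: endofunctor_def)

lemma word_comp:
  "set u \<subseteq> I \<Longrightarrow> f \<in> hom C x y \<Longrightarrow> g \<in> hom C y z \<Longrightarrow>
    on_arr (W u) (comp C g f) = comp C (on_arr (W u) g) (on_arr (W u) f)"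
  using endofunctor_word[of u] hom_obj[of f x y] hom_obj[of g y z] by (simp add: endofunctor_def)

lemma trans_on_hom:
  "trans_on u v \<alpha> \<Longrightarrow> x \<in> obj C \<Longrightarrow> \<alpha> x \<in> hom C (on_obj (W u) x) (on_obj (W v) x)"
  by (simp add: trans_on_def natural_def)

lemma trans_on_set: "trans_on u v \<alpha> \<Longrightarrow> set u \<subseteq> I" "trans_on u v \<alpha> \<Longrightarrow> set v \<subseteq> I"
  by (simp_all add: trans_on_def)

lemma trans_on_natural:
  "trans_on u v \<alpha> \<Longrightarrow> f \<in> hom C x y \<Longrightarrow>
    comp C (\<alpha> y) (on_arr (W u) f) = comp C (on_arr (W v) f) (\<alpha> x)"
  using hom_obj[of f x y] by (simp add: trans_on_def natural_def)

lemma trans_onI: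
  assumes "set u \<subseteq> I" "set v \<subseteq> I"
    and "\<And>x. x \<in> obj C \<Longrightarrow> \<alpha> x \<in> hom C (on_obj (W u) x) (on_obj (W v) x)"
    and "\<And>x y f. f \<in> hom C x y \<Longrightarrow> x \<in> obj C \<Longrightarrow> y \<in> obj C \<Longrightarrow>
      comp C (\<alpha> y) (on_arr (W u) f) = comp C (on_arr (W v) f) (\<alpha> x)"
  shows "trans_on u v \<alpha>"
  using assms by (simp add: trans_on_def natural_def)

lemma trans_on_cong: "\<alpha> \<approx> \<beta> \<Longrightarrow> trans_on u v \<alpha> \<Longrightarrow> trans_on u v \<beta>"
  by (simp add: trans_on_def natural_def nat_eq_def)

lemma trans_on_id: "set u \<subseteq> I \<Longrightarrow> trans_on u u (id_trans u)"
  by (rule trans_onI) (auto intro!: ide_hom word_obj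
      simp: comp_ide_left[OF word_hom] comp_ide_right[OF word_hom])

lemma trans_on_vcomp:
  assumes \<alpha>: "trans_on u v \<alpha>" and \<beta>: "trans_on v w \<beta>"
  shows "trans_on u w (\<beta> \<bullet> \<alpha>)"
proof (rule trans_onI)
  show "set u \<subseteq> I" "set w \<subseteq> I"
    using assms by (auto simp: trans_on_def)
  show "(\<beta> \<bullet> \<alpha>) x \<in> hom C (on_obj (W u) x) (on_obj (W w) x)" if "x \<in> obj C" for x
    unfolding vcomp_def using that assms by (blast intro: comp_hom trans_on_hom)
  fix x y f assume f: "f \<in> hom C x y" and xy: "x \<in> obj C" "y \<in> obj C"
  note hom = trans_on_hom[OF \<alpha> xy(1)] trans_on_hom[OF \<alpha> xy(2)]
    trans_on_hom[OF \<beta> xy(1)] trans_on_hom[OF \<beta> xy(2)]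
  note sets = trans_on_set[OF \<alpha>] trans_on_set[OF \<beta>]
  have "comp C (comp C (\<beta> y) (\<alpha> y)) (on_arr (W u) f)
      = comp C (\<beta> y) (comp C (\<alpha> y) (on_arr (W u) f))"
    by (rule comp_assoc[OF word_hom[OF sets(1) f] hom(2) hom(4)])
  also have "\<dots> = comp C (\<beta> y) (comp C (on_arr (W v) f) (\<alpha> x))"
    by (simp add: trans_on_natural[OF \<alpha> f])
  also have "\<dots> = comp C (comp C (\<beta> y) (on_arr (W v) f)) (\<alpha> x)"
    by (rule comp_assoc[symmetric, OF hom(1) word_hom[OF sets(2) f] hom(4)])
  also have "\<dots> = comp C (comp C (on_arr (W w) f) (\<beta> x)) (\<alpha> x)"
    by (simp add: trans_on_natural[OF \<beta> f])
  also have "\<dots> = comp C (on_arr (W w) f) (comp C (\<beta> x) (\<alpha> x))"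
    by (rule comp_assoc[OF hom(1) hom(3) word_hom[OF sets(4) f]])
  finally show "comp C ((\<beta> \<bullet> \<alpha>) y) (on_arr (W u) f) = comp C (on_arr (W w) f) ((\<beta> \<bullet> \<alpha>) x)"
    by (simp add: vcomp_def)
qed

lemma trans_on_whisker:
  assumes \<alpha>: "trans_on u v \<alpha>" and x: "set x \<subseteq> I" and y: "set y \<subseteq> I"
  shows "trans_on (x @ u @ y) (x @ v @ y) (W x \<rhd> \<alpha> \<lhd> W y)"
proof (rule trans_onI)
  note sets = trans_on_set[OF \<alpha>]
  show "set (x @ u @ y) \<subseteq> I" "set (x @ v @ y) \<subseteq> I"
    using assms sets by auto
  show "(W x \<rhd> \<alpha> \<lhd> W y) c \<in> hom C (on_obj (W (x @ u @ y)) c) (on_obj (W (x @ v @ y)) c)"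
    if "c \<in> obj C" for c
    using that assms
    by (simp add: whisker_left_def whisker_right_def word_endo_append word_hom trans_on_hom word_obj)
  fix c d f assume f: "f \<in> hom C c d" and cd: "c \<in> obj C" "d \<in> obj C"
  let ?g = "on_arr (W y) f"
  have g: "?g \<in> hom C (on_obj (W y) c) (on_obj (W y) d)"
    by (rule word_hom[OF y f])
  note hom = trans_on_hom[OF \<alpha> word_obj[OF y cd(1)]] trans_on_hom[OF \<alpha> word_obj[OF y cd(2)]]
  have "comp C (on_arr (W x) (\<alpha> (on_obj (W y) d))) (on_arr (W x) (on_arr (W u) ?g))
      = on_arr (W x) (comp C (\<alpha> (on_obj (W y) d)) (on_arr (W u) ?g))"
    by (rule word_comp[symmetric, OF x word_hom[OF sets(1) g] hom(2)])
  also have "\<dots> = on_arr (W x) (comp C (on_arr (W v) ?g) (\<alpha> (on_obj (W y) c)))"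
    by (simp add: trans_on_natural[OF \<alpha> g])
  also have "\<dots> = comp C (on_arr (W x) (on_arr (W v) ?g)) (on_arr (W x) (\<alpha> (on_obj (W y) c)))"
    by (rule word_comp[OF x hom(1) word_hom[OF sets(2) g]])
  finally show "comp C ((W x \<rhd> \<alpha> \<lhd> W y) d) (on_arr (W (x @ u @ y)) f)
      = comp C (on_arr (W (x @ v @ y)) f) ((W x \<rhd> \<alpha> \<lhd> W y) c)"
    by (simp add: whisker_left_def whisker_right_def word_endo_append)
qed

lemma whisker_cong: "set y \<subseteq> I \<Longrightarrow> \<alpha> \<approx> \<beta> \<Longrightarrow> F \<rhd> \<alpha> \<lhd> W y \<approx> F \<rhd> \<beta> \<lhd> W y"
  by (simp add: nat_eq_def whisker_left_def whisker_right_def word_obj)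

lemma whisker_vcomp:
  assumes "trans_on u v \<alpha>" "trans_on v w \<beta>" "set x \<subseteq> I" "set y \<subseteq> I"
  shows "W x \<rhd> (\<beta> \<bullet> \<alpha>) \<lhd> W y \<approx> (W x \<rhd> \<beta> \<lhd> W y) \<bullet> (W x \<rhd> \<alpha> \<lhd> W y)"
  using assms
  by (auto simp: nat_eq_def whisker_left_def whisker_right_def vcomp_def
      intro!: word_comp trans_on_hom word_obj)

lemma whisker_id:
  assumes "set x \<subseteq> I" "set u \<subseteq> I" "set y \<subseteq> I"
  shows "W x \<rhd> id_trans u \<lhd> W y \<approx> id_trans (x @ u @ y)"
  using assms endofunctor_word[of x] word_obj
  by (simp add: nat_eq_def whisker_left_def whisker_right_def word_endo_append endofunctor_def)

lemma whisker_whisker: "W x \<rhd> (W x' \<rhd> \<alpha> \<lhd> W y') \<lhd> W y = W (x @ x') \<rhd> \<alpha> \<lhd> W (y' @ y)"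
  by (simp add: whisker_left_def whisker_right_def word_endo_append)

text \<open>This is naturality of \<alpha> at the components of \<beta>.\<close>

lemma interchange:
  assumes "trans_on u v \<alpha>" "trans_on u' v' \<beta>"
  shows "(\<alpha> \<lhd> W v') \<bullet> (W u \<rhd> \<beta>) \<approx> (W v \<rhd> \<beta>) \<bullet> (\<alpha> \<lhd> W u')"
  using trans_on_natural[OF assms(1)] trans_on_hom[OF assms(2)]
  by (simp add: nat_eq_def whisker_left_def whisker_right_def vcomp_def)

text \<open>Carries an axiom, stated as an equation for a composite of two transformations, into a
  surrounding word.\<close>

lemma whisker_vcomp_eq:
  assumes "\<sigma> \<bullet> \<tau> \<approx> \<rho>" "trans_on u v \<tau>" "trans_on v w \<sigma>" "set x \<subseteq> I" "set y \<subseteq> I"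
  shows "(W x \<rhd> \<sigma> \<lhd> W y) \<bullet> (W x \<rhd> \<tau> \<lhd> W y) \<approx> W x \<rhd> \<rho> \<lhd> W y"
  using nat_eq_sym[OF whisker_vcomp[OF assms(2-5)]] whisker_cong[OF assms(5,1)]
  by (rule nat_eq_trans)

text \<open>Moves at disjoint places of a word commute. The separating word t and the tail y are
  absorbed into \<tau>, which leaves an instance of \<open>interchange\<close> whiskered by
  x.\<close>

lemma interchange_whisker:
  assumes \<sigma>: "trans_on b v \<sigma>" and \<tau>: "trans_on c d \<tau>"
    and sets: "set x \<subseteq> I" "set t \<subseteq> I" "set y \<subseteq> I"
  shows "(W x \<rhd> \<sigma> \<lhd> W (t @ d @ y)) \<bullet> (W (x @ b @ t) \<rhd> \<tau> \<lhd> W y) \<approx>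
    (W (x @ v @ t) \<rhd> \<tau> \<lhd> W y) \<bullet> (W x \<rhd> \<sigma> \<lhd> W (t @ c @ y))"
proof -
  let ?\<tau> = "W t \<rhd> \<tau> \<lhd> W y"
  have \<tau>': "trans_on (t @ c @ y) (t @ d @ y) ?\<tau>"
    by (rule trans_on_whisker[OF \<tau> sets(2,3)])
  note I = trans_on_set[OF \<sigma>] trans_on_set[OF \<tau>']
  have \<sigma>\<tau>: "trans_on (b @ z) (v @ z) (\<sigma> \<lhd> W z)" if "set z \<subseteq> I" for z
    using trans_on_whisker[OF \<sigma>, of "[]" z] that by simp
  have \<tau>'': "trans_on (z @ t @ c @ y) (z @ t @ d @ y) (W z \<rhd> ?\<tau>)" if "set z \<subseteq> I" for z
    using trans_on_whisker[OF \<tau>', of z "[]"] that by simp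
  have "(W x \<rhd> (\<sigma> \<lhd> W (t @ d @ y)) \<lhd> W []) \<bullet> (W x \<rhd> (W b \<rhd> ?\<tau>) \<lhd> W []) \<approx>
      W x \<rhd> ((W v \<rhd> ?\<tau>) \<bullet> (\<sigma> \<lhd> W (t @ c @ y))) \<lhd> W []"
    by (rule whisker_vcomp_eq[OF interchange[OF \<sigma> \<tau>'] \<tau>''[OF I(1)] \<sigma>\<tau>[OF I(4)] sets(1)]) simp
  also have "\<dots> \<approx> (W x \<rhd> (W v \<rhd> ?\<tau>) \<lhd> W []) \<bullet> (W x \<rhd> (\<sigma> \<lhd> W (t @ c @ y)) \<lhd> W [])"
    by (rule whisker_vcomp[OF \<sigma>\<tau>[OF I(3)] \<tau>''[OF I(2)] sets(1)]) simp
  finally show ?thesis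
    by (simp add: word_endo_append whisker_left_comp)
qed

lemma vcomp_assoc:
  assumes "trans_on u v \<alpha>" "trans_on v w \<beta>" "trans_on w z \<gamma>"
  shows "(\<gamma> \<bullet> \<beta>) \<bullet> \<alpha> \<approx> \<gamma> \<bullet> \<beta> \<bullet> \<alpha>"
  using assms by (auto simp: nat_eq_def vcomp_def intro: comp_assoc trans_on_hom)

lemma vcomp_id_left: "trans_on u v \<alpha> \<Longrightarrow> id_trans v \<bullet> \<alpha> \<approx> \<alpha>"
  by (auto simp: nat_eq_def vcomp_def intro: comp_ide_left trans_on_hom)

lemma vcomp_id_right: "trans_on u v \<alpha> \<Longrightarrow> \<alpha> \<bullet> id_trans u \<approx> \<alpha>"
  by (auto simp: nat_eq_def vcomp_def intro: comp_ide_right trans_on_hom)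

section \<open>Composites of moves\<close>

text \<open>Kept apart from the units because these moves terminate, whereas units can be inserted
  forever.\<close>

inductive reduction :: "nat list \<Rightarrow> nat list \<Rightarrow> ('o \<Rightarrow> 'm) \<Rightarrow> bool" where
  swap: "p \<in> I \<Longrightarrow> q \<in> I \<Longrightarrow> q < p \<Longrightarrow> reduction [p, q] [q, p] (lam p q)"
| mult: "p \<in> I \<Longrightarrow> reduction [p, p] [p] (mult (T p))"

inductive generator :: "nat list \<Rightarrow> nat list \<Rightarrow> ('o \<Rightarrow> 'm) \<Rightarrow> bool" where
  reduction: "reduction u v s \<Longrightarrow> generator u v s"
| unit: "p \<in> I \<Longrightarrow> generator [] [p] (unit (T p))"

text \<open>Unlike \<open>swap_composite\<close>, this predicate is closed under \<open>nat_eq\<close>; otherwise it would not be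
  closed under whiskering and \<open>vcomp\<close>, whose laws only hold on the carrier.\<close>

inductive composite ::
  "(nat list \<Rightarrow> nat list \<Rightarrow> ('o \<Rightarrow> 'm) \<Rightarrow> bool) \<Rightarrow> nat list \<Rightarrow> nat list \<Rightarrow> ('o \<Rightarrow> 'm) \<Rightarrow> bool"
  for R where
  refl: "set w \<subseteq> I \<Longrightarrow> \<alpha> \<approx> id_trans w \<Longrightarrow> composite R w w \<alpha>"
| step: "R u v s \<Longrightarrow> set x \<subseteq> I \<Longrightarrow> set y \<subseteq> I \<Longrightarrow> composite R (x @ v @ y) w \<alpha> \<Longrightarrow>
    \<beta> \<approx> \<alpha> \<bullet> (W x \<rhd> s \<lhd> W y) \<Longrightarrow> composite R (x @ u @ y) w \<beta>"

lemma trans_on_generator: "generator u v s \<Longrightarrow> trans_on u v s"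
proof (induction rule: generator.induct)
  case (reduction u v s)
  then show ?case
  proof cases
    case (swap p q)
    then show ?thesis
      using law[of p q] by (simp add: distributive_law_def trans_on_def)
  next
    case (mult p)
    then show ?thesis
      using monad[of p] by (simp add: is_monad_def trans_on_def)
  qed
next
  case (unit p)
  then show ?case
    using monad[of p] by (simp add: is_monad_def trans_on_def)
qed

text \<open>The condition \<open>R \<le> generator\<close> makes this and the following lemmas
  available both for reductions and for arbitrary moves.\<close>

lemma trans_on_rule: "R \<le> generator \<Longrightarrow> R u v s \<Longrightarrow> trans_on u v s"
  by (auto simp: le_fun_def intro: trans_on_generator)

lemma trans_on_step:
  "R \<le> generator \<Longrightarrow> R u v s \<Longrightarrow> set x \<subseteq> I \<Longrightarrow> set y \<subseteq> I \<Longrightarrow>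
    trans_on (x @ u @ y) (x @ v @ y) (W x \<rhd> s \<lhd> W y)"
  by (intro trans_on_whisker trans_on_rule)

lemma trans_on_composite:
  assumes R: "R \<le> generator"
  shows "composite R u w \<alpha> \<Longrightarrow> trans_on u w \<alpha>"
proof (induction rule: composite.induct)
  case (refl w \<alpha>)
  then show ?case
    by (blast intro: trans_on_cong trans_on_id nat_eq_sym)
next
  case (step u v s x y w \<alpha> \<beta>)
  then show ?case
    by (blast intro: trans_on_cong trans_on_vcomp trans_on_step[OF R] nat_eq_sym)
qed

lemma composite_cong: "composite R u w \<alpha> \<Longrightarrow> \<beta> \<approx> \<alpha> \<Longrightarrow> composite R u w \<beta>"
  by (erule composite.cases) (blast intro: composite.intros nat_eq_trans)+

lemma composite_mono:
  assumes "composite R u w \<alpha>" and "R \<le> R'"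
  shows "composite R' u w \<alpha>"
  using assms(1)
proof (induction rule: composite.induct)
  case (refl w \<alpha>)
  then show ?case
    by (rule composite.refl)
next
  case (step u v s x y w \<alpha> \<beta>)
  have "R' u v s"
    using step(1) assms(2) by (auto simp: le_fun_def)
  then show ?case
    using step composite.step by blast
qed

text \<open>Concatenation of move sequences; \<beta> is carried through the induction on \<alpha> by
  associativity.\<close>

lemma composite_vcomp:
  assumes R: "R \<le> generator" and \<alpha>: "composite R u v \<alpha>" and \<beta>: "composite R v w \<beta>"
  shows "composite R u w (\<beta> \<bullet> \<alpha>)"
  using \<alpha> \<beta>
proof (induction rule: composite.induct)
  case (refl v \<alpha>)
  have "\<beta> \<bullet> \<alpha> \<approx> \<beta> \<bullet> id_trans v"
    using refl(2) by (rule vcomp_cong[OF nat_eq_refl])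
  also have "\<dots> \<approx> \<beta>"
    by (rule vcomp_id_right[OF trans_on_composite[OF R refl(3)]])
  finally show ?case
    using refl(3) composite_cong by blast
next
  case (step u v' s x y v \<alpha> \<gamma>)
  have "\<beta> \<bullet> \<gamma> \<approx> \<beta> \<bullet> (\<alpha> \<bullet> (W x \<rhd> s \<lhd> W y))"
    using step.hyps(5) by (rule vcomp_cong[OF nat_eq_refl])
  also have "\<dots> \<approx> (\<beta> \<bullet> \<alpha>) \<bullet> (W x \<rhd> s \<lhd> W y)"
    by (rule nat_eq_sym, rule vcomp_assoc[OF trans_on_step[OF R step.hyps(1-3)]
          trans_on_composite[OF R step.hyps(4)] trans_on_composite[OF R step.prems]])
  finally show ?case
    using step.hyps step.IH[OF step.prems] composite.step by blast
qed

lemma composite_whisker: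
  assumes R: "R \<le> generator" and xy: "set x \<subseteq> I" "set y \<subseteq> I"
  shows "composite R u w \<alpha> \<Longrightarrow> composite R (x @ u @ y) (x @ w @ y) (W x \<rhd> \<alpha> \<lhd> W y)"
proof (induction rule: composite.induct[of R])
  case (refl w \<alpha>)
  then show ?case
    using xy by (intro composite.refl) (auto intro: nat_eq_trans whisker_cong whisker_id)
next
  case (step u v s x' y' w \<alpha> \<beta>)
  have "W x \<rhd> \<beta> \<lhd> W y \<approx> W x \<rhd> (\<alpha> \<bullet> (W x' \<rhd> s \<lhd> W y')) \<lhd> W y"
    using step xy by (intro whisker_cong)
  also have "\<dots> \<approx> (W x \<rhd> \<alpha> \<lhd> W y) \<bullet> (W x \<rhd> (W x' \<rhd> s \<lhd> W y') \<lhd> W y)"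
    by (rule whisker_vcomp[OF trans_on_step[OF R step.hyps(1-3)]
          trans_on_composite[OF R step.hyps(4)] xy])
  finally have "W x \<rhd> \<beta> \<lhd> W y \<approx> (W x \<rhd> \<alpha> \<lhd> W y) \<bullet> (W (x @ x') \<rhd> s \<lhd> W (y' @ y))"
    by (simp add: whisker_whisker)
  then have "composite R ((x @ x') @ u @ y' @ y) (x @ w @ y) (W x \<rhd> \<beta> \<lhd> W y)"
    using step xy composite.step[of R u v s "x @ x'" "y' @ y" "x @ w @ y" "W x \<rhd> \<alpha> \<lhd> W y"]
    by simp
  then show ?case
    by simp
qed

lemma composite_single:
  assumes R: "R \<le> generator" and s: "R u v s"
  shows "composite R u v s"
proof -
  have s': "trans_on u v s"
    using assms by (rule trans_on_rule)
  then have "s \<approx> id_trans v \<bullet> (W [] \<rhd> s \<lhd> W [])"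
    using nat_eq_sym[OF vcomp_id_left] by simp
  moreover have "composite R ([] @ v @ []) v (id_trans v)"
    using trans_on_set(2)[OF s'] by (simp add: composite.refl)
  ultimately have "composite R ([] @ u @ []) v s"
    using composite.step[of R u v s "[]" "[]"] s by simp
  then show ?thesis
    by simp
qed

lemma composite_left:
  "R \<le> generator \<Longrightarrow> set x \<subseteq> I \<Longrightarrow> composite R u w \<alpha> \<Longrightarrow> composite R (x @ u) (x @ w) (W x \<rhd> \<alpha>)"
  using composite_whisker[of R x "[]" u w \<alpha>] by simp

lemma composite_right:
  "R \<le> generator \<Longrightarrow> set y \<subseteq> I \<Longrightarrow> composite R u w \<alpha> \<Longrightarrow> composite R (u @ y) (w @ y) (\<alpha> \<lhd> W y)"
  using composite_whisker[of R "[]" y u w \<alpha>] by simp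

lemma composite_set: "composite generator u w \<alpha> \<Longrightarrow> set u \<subseteq> I \<and> set w \<subseteq> I"
  using trans_on_composite[of generator] by (auto simp: trans_on_def)

lemma reduction_le: "reduction \<le> generator"
  by (auto simp: le_fun_def intro: generator.reduction)

lemmas reduction_composite = composite_single[OF reduction_le]
lemmas trans_on_reduction = trans_on_rule[OF reduction_le]
lemmas trans_on_reductions = trans_on_composite[OF reduction_le]

section \<open>Uniqueness of reductions to normal form\<close>

text \<open>Joinability in the sense of rewriting, strengthened: the words v and v' have a common
  reduct, and the resulting square of transformations commutes.\<close>

definition joinable where
  "joinable v \<alpha> v' \<beta> \<longleftrightarrow>
    (\<exists>w \<gamma> \<delta>. composite reduction v w \<gamma> \<and> composite reduction v' w \<delta> \<and> \<gamma> \<bullet> \<alpha> \<approx> \<delta> \<bullet> \<beta>)"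

lemma joinable_sym: "joinable v \<alpha> v' \<beta> \<Longrightarrow> joinable v' \<beta> v \<alpha>"
  unfolding joinable_def using nat_eq_sym by blast

lemma joinable_refl: "set v \<subseteq> I \<Longrightarrow> joinable v \<alpha> v \<alpha>"
  unfolding joinable_def by (blast intro: composite.refl nat_eq_refl)

lemma joinable_whisker:
  assumes "joinable v \<alpha> v' \<beta>" and \<alpha>: "trans_on u v \<alpha>" and \<beta>: "trans_on u v' \<beta>"
    and xy: "set x \<subseteq> I" "set y \<subseteq> I"
  shows "joinable (x @ v @ y) (W x \<rhd> \<alpha> \<lhd> W y) (x @ v' @ y) (W x \<rhd> \<beta> \<lhd> W y)"
proof -
  obtain w \<gamma> \<delta> where \<gamma>: "composite reduction v w \<gamma>" and \<delta>: "composite reduction v' w \<delta>"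
    and eq: "\<gamma> \<bullet> \<alpha> \<approx> \<delta> \<bullet> \<beta>"
    using assms by (auto simp: joinable_def)
  have "(W x \<rhd> \<gamma> \<lhd> W y) \<bullet> (W x \<rhd> \<alpha> \<lhd> W y) \<approx> W x \<rhd> (\<gamma> \<bullet> \<alpha>) \<lhd> W y"
    by (rule nat_eq_sym, rule whisker_vcomp[OF \<alpha> trans_on_reductions[OF \<gamma>] xy])
  also have "\<dots> \<approx> W x \<rhd> (\<delta> \<bullet> \<beta>) \<lhd> W y"
    by (rule whisker_cong[OF xy(2) eq])
  also have "\<dots> \<approx> (W x \<rhd> \<delta> \<lhd> W y) \<bullet> (W x \<rhd> \<beta> \<lhd> W y)"
    by (rule whisker_vcomp[OF \<beta> trans_on_reductions[OF \<delta>] xy])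
  finally show ?thesis
    unfolding joinable_def
    using composite_whisker[OF reduction_le xy \<gamma>] composite_whisker[OF reduction_le xy \<delta>] by blast
qed

section \<open>Local confluence: overlapping and disjoint redexes\<close>

lemma swap_mult_pentagons:
  assumes "p \<in> I" "q \<in> I" "q < p"
  shows "lam p q \<bullet> (mult (T p) \<lhd> endo (T q)) \<approx>
      (endo (T q) \<rhd> mult (T p)) \<bullet> (lam p q \<lhd> endo (T p)) \<bullet> (endo (T p) \<rhd> lam p q)"
    and "lam p q \<bullet> (endo (T p) \<rhd> mult (T q)) \<approx>
      (mult (T q) \<lhd> endo (T p)) \<bullet> (endo (T q) \<rhd> lam p q) \<bullet> (lam p q \<lhd> endo (T q))"
  using law[of p q] assms by (simp_all add: distributive_law_def)

lemma critical_pair: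
  assumes r1: "reduction [p, q] v1 s1" and r2: "reduction [q, r] v2 s2"
  shows "joinable (v1 @ [r]) (s1 \<lhd> W [r]) ([p] @ v2) (W [p] \<rhd> s2)"
proof -
  have I: "p \<in> I" "q \<in> I" "r \<in> I"
    using assms by (auto elim!: reduction.cases)
  have left: "composite reduction (a # u) (a # v) (endo (T a) \<rhd> s)"
    if "reduction u v s" "a \<in> I" for a u v s
    using composite_left[OF reduction_le _ reduction_composite[OF that(1)], of "[a]"] that by simp
  have right: "composite reduction (u @ [a]) (v @ [a]) (s \<lhd> endo (T a))"
    if "reduction u v s" "a \<in> I" for a u v s
    using composite_right[OF reduction_le _ reduction_composite[OF that(1)], of "[a]"] that by simp
  note compose = composite_vcomp[OF reduction_le]
  note assoc = vcomp_assoc[OF trans_on_reductions trans_on_reductions trans_on_reductions]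
  \<comment> \<open>Each of the two redexes is a descent or a repetition, which gives four shapes of
    the word pqr.\<close>
  consider "q < p" "r < q" | "p = q" "r < q" | "q < p" "q = r" | "p = q" "q = r"
    using assms by (auto elim!: reduction.cases)
  then show ?thesis
  proof cases
    case 1
    have eq: "v1 = [q, p]" "s1 = lam p q" "v2 = [r, q]" "s2 = lam q r"
      using 1 r1 r2 by (auto elim: reduction.cases)
    note pq = swap[OF I(1,2) 1(1)] and qr = swap[OF I(2,3) 1(2)]
    have pr: "reduction [p, r] [r, p] (lam p r)"
      using 1 I by (intro swap) auto
    note c = left[OF pq I(3)] right[OF pq I(3)] left[OF qr I(1)] right[OF qr I(1)]
      left[OF pr I(2)] right[OF pr I(2)]
    note c = c[simplified]
    \<comment> \<open>The Yang--Baxter hexagon from pqr to rqp. Joinability brackets the composites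
      to the left and the axiom to the right, hence the two uses of associativity.\<close>
    have "((lam q r \<lhd> endo (T p)) \<bullet> (endo (T q) \<rhd> lam p r)) \<bullet> (lam p q \<lhd> endo (T r)) \<approx>
        (lam q r \<lhd> endo (T p)) \<bullet> (endo (T q) \<rhd> lam p r) \<bullet> (lam p q \<lhd> endo (T r))"
      by (rule assoc[OF c(2,5,4)])
    also have "\<dots> \<approx> (endo (T r) \<rhd> lam p q) \<bullet> (lam p r \<lhd> endo (T q)) \<bullet> (endo (T p) \<rhd> lam q r)"
      using yb[OF I 1(2,1)] by (simp add: yang_baxter_def)
    also have "\<dots> \<approx> ((endo (T r) \<rhd> lam p q) \<bullet> (lam p r \<lhd> endo (T q))) \<bullet> (endo (T p) \<rhd> lam q r)"
      by (rule nat_eq_sym, rule assoc[OF c(3,6,1)])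
    finally show ?thesis
      unfolding joinable_def eq using compose[OF c(5,4)] compose[OF c(6,1)] by auto
  next
    case 2
    have eq: "v1 = [p]" "s1 = mult (T p)" "v2 = [r, p]" "s2 = lam p r"
      using 2 r1 r2 by (auto elim: reduction.cases)
    have pr: "reduction [p, r] [r, p] (lam p r)" and pp: "reduction [p, p] [p] (mult (T p))"
      using 2 I by (auto intro: swap mult)
    note c = left[OF pr I(1)] right[OF pr I(1)] left[OF pp I(3)]
    note c = c[simplified]
    \<comment> \<open>The word is ppr: compatibility of the law with the multiplication of the monad
      on its left.\<close>
    have "lam p r \<bullet> (mult (T p) \<lhd> endo (T r)) \<approx>
        (endo (T r) \<rhd> mult (T p)) \<bullet> (lam p r \<lhd> endo (T p)) \<bullet> (endo (T p) \<rhd> lam p r)"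
      using 2 I by (intro swap_mult_pentagons) auto
    also have "\<dots> \<approx> ((endo (T r) \<rhd> mult (T p)) \<bullet> (lam p r \<lhd> endo (T p))) \<bullet> (endo (T p) \<rhd> lam p r)"
      by (rule nat_eq_sym, rule assoc[OF c])
    finally show ?thesis
      unfolding joinable_def eq using compose[OF c(2,3)] reduction_composite[OF pr] by auto
  next
    case 3
    have eq: "v1 = [r, p]" "s1 = lam p r" "v2 = [r]" "s2 = mult (T r)"
      using 3 r1 r2 by (auto elim: reduction.cases)
    have pr: "reduction [p, r] [r, p] (lam p r)" and rr: "reduction [r, r] [r] (mult (T r))"
      using 3 I by (auto intro: swap mult)
    note c = right[OF pr I(3)] left[OF pr I(3)] right[OF rr I(1)]
    note c = c[simplified]
    \<comment> \<open>The word is prr: compatibility of the law with the multiplication of the other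
      monad.\<close>
    have "((mult (T r) \<lhd> endo (T p)) \<bullet> (endo (T r) \<rhd> lam p r)) \<bullet> (lam p r \<lhd> endo (T r)) \<approx>
        (mult (T r) \<lhd> endo (T p)) \<bullet> (endo (T r) \<rhd> lam p r) \<bullet> (lam p r \<lhd> endo (T r))"
      by (rule assoc[OF c])
    also have "\<dots> \<approx> lam p r \<bullet> (endo (T p) \<rhd> mult (T r))"
      using 3 I by (intro nat_eq_sym[OF swap_mult_pentagons(2)]) auto
    finally show ?thesis
      unfolding joinable_def eq using compose[OF c(2,3)] reduction_composite[OF pr] by auto
  next
    case 4
    have eq: "v1 = [p]" "s1 = mult (T p)" "v2 = [p]" "s2 = mult (T p)"
      using 4 r1 r2 by (auto elim: reduction.cases)
    have "mult (T p) \<bullet> (mult (T p) \<lhd> endo (T p)) \<approx> mult (T p) \<bullet> (endo (T p) \<rhd> mult (T p))"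
      using monad[OF I(1)] by (simp add: is_monad_def)
    then show ?thesis
      unfolding joinable_def eq using 4 reduction_composite[OF mult[OF I(1)]] by auto
  qed
qed

text \<open>Each move can still be made after the other, and the order does not matter by
  \<open>interchange_whisker\<close>.\<close>

lemma disjoint_pair:
  assumes r1: "reduction b1 v1 s1" and r2: "reduction b2 v2 s2" and yz: "set y \<subseteq> I" "set z \<subseteq> I"
  shows "joinable (v1 @ y @ b2 @ z) (s1 \<lhd> W (y @ b2 @ z)) (b1 @ y @ v2 @ z) (W (b1 @ y) \<rhd> s2 \<lhd> W z)"
proof -
  note s1 = trans_on_reduction[OF r1] and s2 = trans_on_reduction[OF r2]
  note sets = trans_on_set[OF s1] trans_on_set[OF s2] yz
  have "(W (v1 @ y) \<rhd> s2 \<lhd> W z) \<bullet> (s1 \<lhd> W (y @ b2 @ z)) \<approx>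
      (s1 \<lhd> W (y @ v2 @ z)) \<bullet> (W (b1 @ y) \<rhd> s2 \<lhd> W z)"
    using nat_eq_sym[OF interchange_whisker[OF s1 s2 _ yz, of "[]"]] by simp
  moreover have "composite reduction (v1 @ y @ b2 @ z) (v1 @ y @ v2 @ z) (W (v1 @ y) \<rhd> s2 \<lhd> W z)"
    using composite_whisker[OF reduction_le _ _ reduction_composite[OF r2], of "v1 @ y" z] sets
    by simp
  moreover have "composite reduction (b1 @ y @ v2 @ z) (v1 @ y @ v2 @ z) (s1 \<lhd> W (y @ v2 @ z))"
    using composite_right[OF reduction_le _ reduction_composite[OF r1], of "y @ v2 @ z"] sets
    by simp
  ultimately show ?thesis
    unfolding joinable_def by blast
qed

lemma reduction_pair: "reduction u v s \<Longrightarrow> \<exists>p q. u = [p, q]"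
  by (auto elim: reduction.cases)

lemma reduction_unique: "reduction u v s \<Longrightarrow> reduction u v' s' \<Longrightarrow> v' = v \<and> s' = s"
  by (auto elim!: reduction.cases)

lemma local_confluence_ordered:
  assumes r1: "reduction b1 v1 s1" and r2: "reduction b2 v2 s2"
    and eq: "x1 @ b1 @ y1 = x2 @ b2 @ y2" and sets: "set (x1 @ b1 @ y1) \<subseteq> I"
    and le: "length x1 \<le> length x2"
  shows "joinable (x1 @ v1 @ y1) (W x1 \<rhd> s1 \<lhd> W y1) (x2 @ v2 @ y2) (W x2 \<rhd> s2 \<lhd> W y2)"
proof -
  obtain p q where b1: "b1 = [p, q]"
    using reduction_pair[OF r1] by blast
  obtain p' q' where b2: "b2 = [p', q']"
    using reduction_pair[OF r2] by blast
  note s1 = trans_on_reduction[OF r1] and s2 = trans_on_reduction[OF r2]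
  have sets': "set x1 \<subseteq> I" "set y1 \<subseteq> I" "set x2 \<subseteq> I" "set y2 \<subseteq> I" "set b1 \<subseteq> I" "set v1 \<subseteq> I"
    using sets sets[unfolded eq] trans_on_set[OF s1] by auto
  \<comment> \<open>The first redex starts no later than the second, so x1 is a prefix of x2; the
    word t measures the distance between the two starting positions.\<close>
  have "take (length x1) x2 = x1"
    using arg_cong[OF eq, of "take (length x1)"] le by simp
  then obtain t where t: "x2 = x1 @ t" "b1 @ y1 = t @ b2 @ y2"
    using eq by (metis append.assoc append_take_drop_id same_append_eq)
  \<comment> \<open>Redexes have two letters, so they coincide, overlap in one letter, or are
    disjoint.\<close>
  consider "t = []" | "t = [p]" | t' where "t = [p, q] @ t'"
    using t(2) b1 by (cases t; cases "tl t") auto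
  then show ?thesis
  proof cases
    case 1
    then have "b1 = b2" "y1 = y2"
      using t(2) b1 b2 by auto
    then show ?thesis
      using 1 t(1) reduction_unique[OF r1] r2 sets' by (auto intro!: joinable_refl)
  next
    case 2
    then have p': "p' = q" and y1: "y1 = [q'] @ y2"
      using t(2) b1 b2 by auto
    have q': "q' \<in> I" "p \<in> I"
      using sets y1 b1 by auto
    have "joinable (v1 @ [q']) (s1 \<lhd> W [q']) ([p] @ v2) (W [p] \<rhd> s2)"
      using critical_pair[of p q v1 s1 q' v2 s2] r1 r2 b1 b2 p' by simp
    moreover have "trans_on ([p, q] @ [q']) (v1 @ [q']) (s1 \<lhd> W [q'])"
      using trans_on_whisker[OF s1, of "[]" "[q']"] q' b1 by simp
    moreover have "trans_on ([p, q] @ [q']) ([p] @ v2) (W [p] \<rhd> s2)"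
      using trans_on_whisker[OF s2, of "[p]" "[]"] q' b2 p' by simp
    ultimately have "joinable (x1 @ (v1 @ [q']) @ y2) (W x1 \<rhd> (s1 \<lhd> W [q']) \<lhd> W y2)
        (x1 @ ([p] @ v2) @ y2) (W x1 \<rhd> (W [p] \<rhd> s2) \<lhd> W y2)"
      using sets' by (intro joinable_whisker)
    then show ?thesis
      using 2 t(1) y1
      by (simp add: word_endo_append whisker_left_comp whisker_right_comp whisker_left_right)
  next
    case 3
    then have y1: "y1 = t' @ b2 @ y2"
      using t(2) b1 by auto
    have t': "set t' \<subseteq> I"
      using sets y1 by auto
    have "joinable (v1 @ y1) (s1 \<lhd> W y1) (b1 @ t' @ v2 @ y2) (W (b1 @ t') \<rhd> s2 \<lhd> W y2)"
      unfolding y1 by (rule disjoint_pair[OF r1 r2 t' sets'(4)])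
    moreover have "trans_on (b1 @ y1) (v1 @ y1) (s1 \<lhd> W y1)"
      using trans_on_whisker[OF s1, of "[]" y1] sets' by simp
    moreover have "trans_on (b1 @ y1) (b1 @ t' @ v2 @ y2) (W (b1 @ t') \<rhd> s2 \<lhd> W y2)"
      using trans_on_whisker[OF s2, of "b1 @ t'" y2] sets' t' y1 by simp
    ultimately have "joinable (x1 @ (v1 @ y1) @ []) (W x1 \<rhd> (s1 \<lhd> W y1) \<lhd> W [])
        (x1 @ (b1 @ t' @ v2 @ y2) @ []) (W x1 \<rhd> (W (b1 @ t') \<rhd> s2 \<lhd> W y2) \<lhd> W [])"
      using sets' by (intro joinable_whisker) auto
    then show ?thesis
      using 3 t(1) b1
      by (simp add: word_endo_append whisker_left_comp whisker_right_comp whisker_left_right)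
  qed
qed

lemma local_confluence:
  assumes r1: "reduction b1 v1 s1" and r2: "reduction b2 v2 s2"
    and eq: "x1 @ b1 @ y1 = x2 @ b2 @ y2" and sets: "set (x1 @ b1 @ y1) \<subseteq> I"
  shows "joinable (x1 @ v1 @ y1) (W x1 \<rhd> s1 \<lhd> W y1) (x2 @ v2 @ y2) (W x2 \<rhd> s2 \<lhd> W y2)"
proof (cases "length x1 \<le> length x2")
  case True
  then show ?thesis
    by (rule local_confluence_ordered[OF assms])
next
  case False
  then show ?thesis
    using local_confluence_ordered[OF r2 r1 eq[symmetric]] sets[unfolded eq]
    by (auto intro: joinable_sym)
qed

section \<open>Termination, normal forms and uniqueness of reductions\<close>

lemma reduction_set: "reduction u v s \<Longrightarrow> set v = set u"
  by (auto elim: reduction.cases)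

lemma generator_set: "generator u v s \<Longrightarrow> set u \<subseteq> set v"
  by (auto elim!: generator.cases dest: reduction_set)

text \<open>A swap keeps the length and decreases the word lexicographically; a multiplication
  shortens it.\<close>

lemma reduction_less: "reduction u v s \<Longrightarrow> (x @ v @ y, x @ u @ y) \<in> lenlex less_than"
  by (auto elim!: reduction.cases simp: lenlex_conv lex_append_leftI)

lemma no_reduction: "reduction u v s \<Longrightarrow> \<not> sorted_wrt (<) (x @ u @ y)"
  by (auto elim!: reduction.cases simp: sorted_wrt_append)

text \<open>An adjacent pair that does not increase is a descent, which can be swapped, or a
  repetition, which can be multiplied. With \<open>no_reduction\<close>, the normal forms over
  \<open>I\<close> are exactly the strictly increasing words.\<close>

lemma obtain_reduction:
  assumes "\<not> sorted_wrt (<) u" and "set u \<subseteq> I"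
  obtains x b y v s where "u = x @ b @ y" and "reduction b v s"
proof -
  have "transp ((<) :: nat \<Rightarrow> nat \<Rightarrow> bool)"
    by simp
  then obtain x p q y where u: "u = x @ [p, q] @ y" "\<not> p < q"
    using not_sorted_wrt_adjacent assms(1) by metis
  then have "p \<in> I" "q \<in> I"
    using assms(2) by auto
  then have "\<exists>v s. reduction [p, q] v s"
    using u(2) swap[of p q] mult[of p] by (cases "p = q") auto
  then show ?thesis
    using u(1) that by blast
qed

lemma composite_generator_set: "composite generator u w \<alpha> \<Longrightarrow> set u \<subseteq> set w"
  by (induction rule: composite.induct) (auto dest!: generator_set)

lemma composite_reduction_set: "composite reduction u w \<alpha> \<Longrightarrow> set u = set w"
  by (induction rule: composite.induct) (auto dest!: reduction_set)

lemma reduction_step_composite: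
  "reduction b v s \<Longrightarrow> set x \<subseteq> I \<Longrightarrow> set y \<subseteq> I \<Longrightarrow>
    composite reduction (x @ b @ y) (x @ v @ y) (W x \<rhd> s \<lhd> W y)"
  by (blast intro: composite_whisker[OF reduction_le] reduction_composite)

text \<open>Reducing as long as possible ends in a strictly increasing word with the same letters,
  and such a word is determined by its set of letters.\<close>

lemma reductions_exist:
  assumes "set u = set w" and w: "sorted_wrt (<) w" "set w \<subseteq> I"
  shows "\<exists>\<alpha>. composite reduction u w \<alpha>"
  using wf_lenlex[OF wf_less_than] assms(1)
proof (induction u rule: wf_induct_rule)
  case (less u)
  show ?case
  proof (cases "sorted_wrt (<) u")
    case True
    then have "u = w"
      using less.prems w strict_sorted_equal by blast
    then show ?thesis
      using w(2) composite.refl nat_eq_refl by blast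
  next
    case False
    obtain x b y v s where u: "u = x @ b @ y" and r: "reduction b v s"
      using obtain_reduction[OF False] less.prems w(2) by blast
    have "set (x @ v @ y) = set w"
      using less.prems reduction_set[OF r] u by simp
    then obtain \<alpha> where "composite reduction (x @ v @ y) w \<alpha>"
      using less.IH[of "x @ v @ y"] reduction_less[OF r] u by blast
    moreover have "set x \<subseteq> I" "set y \<subseteq> I"
      using less.prems w(2) u by auto
    ultimately have "composite reduction (x @ b @ y) w (\<alpha> \<bullet> (W x \<rhd> s \<lhd> W y))"
      using composite_vcomp[OF reduction_le reduction_step_composite[OF r]] by blast
    then show ?thesis
      using u by blast
  qed
qed

text \<open>Newman's argument, with commuting diagrams of transformations in place of mere words:
  well-founded induction on u, starting from the first moves of the two composites.\<close>

lemma reductions_unique: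
  assumes w: "sorted_wrt (<) w" and "composite reduction u w \<alpha>" "composite reduction u w \<beta>"
  shows "\<alpha> \<approx> \<beta>"
  using wf_lenlex[OF wf_less_than] assms(2,3)
proof (induction u arbitrary: \<alpha> \<beta> rule: wf_induct_rule)
  case (less u)
  show ?case
  proof (cases "u = w")
    case True
    \<comment> \<open>The word w is irreducible, so the only composite from it is the empty
      one.\<close>
    have "\<gamma> \<approx> id_trans w" if "composite reduction u w \<gamma>" for \<gamma>
      using that
    proof cases
      case (step b v s x y \<alpha>)
      then show ?thesis
        using no_reduction[of b v s x y] w True by simp
    qed simp
    then show ?thesis
      using less.prems nat_eq_sym nat_eq_trans by blast
  next
    case False
    obtain x1 b1 y1 v1 s1 \<alpha>' where u1: "u = x1 @ b1 @ y1" and r1: "reduction b1 v1 s1"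
      and \<alpha>': "composite reduction (x1 @ v1 @ y1) w \<alpha>'"
      and \<alpha>: "\<alpha> \<approx> \<alpha>' \<bullet> (W x1 \<rhd> s1 \<lhd> W y1)" and s1: "set x1 \<subseteq> I" "set y1 \<subseteq> I"
      using less.prems(1) False by cases auto
    obtain x2 b2 y2 v2 s2 \<beta>' where u2: "u = x2 @ b2 @ y2" and r2: "reduction b2 v2 s2"
      and \<beta>': "composite reduction (x2 @ v2 @ y2) w \<beta>'"
      and \<beta>: "\<beta> \<approx> \<beta>' \<bullet> (W x2 \<rhd> s2 \<lhd> W y2)" and s2: "set x2 \<subseteq> I" "set y2 \<subseteq> I"
      using less.prems(2) False by cases auto
    have u: "set u \<subseteq> I" "set u = set w"
      using less.prems(1) composite_reduction_set composite_set composite_mono[OF _ reduction_le]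
      by blast+
    obtain z \<gamma> \<delta> where \<gamma>: "composite reduction (x1 @ v1 @ y1) z \<gamma>"
      and \<delta>: "composite reduction (x2 @ v2 @ y2) z \<delta>"
      and eq: "\<gamma> \<bullet> (W x1 \<rhd> s1 \<lhd> W y1) \<approx> \<delta> \<bullet> (W x2 \<rhd> s2 \<lhd> W y2)"
      using local_confluence[OF r1 r2] u(1) u1 u2 unfolding joinable_def by metis
    \<comment> \<open>Reductions preserve the set of letters, so the common reduct z reduces to w as
      well. This closes the diagram, and the induction hypothesis applies at both first
      reducts.\<close>
    have "set z = set w"
      using composite_reduction_set[OF \<gamma>] composite_reduction_set[OF \<alpha>'] by simp
    then obtain \<epsilon> where \<epsilon>: "composite reduction z w \<epsilon>"
      using reductions_exist w u by blast
    note t\<epsilon> = trans_on_reductions[OF \<epsilon>]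
    have "\<alpha> \<approx> \<alpha>' \<bullet> (W x1 \<rhd> s1 \<lhd> W y1)"
      by (rule \<alpha>)
    also have "\<dots> \<approx> (\<epsilon> \<bullet> \<gamma>) \<bullet> (W x1 \<rhd> s1 \<lhd> W y1)"
      using less.IH[OF _ \<alpha>' composite_vcomp[OF reduction_le \<gamma> \<epsilon>]] reduction_less[OF r1] u1
      by (intro vcomp_cong[OF _ nat_eq_refl]) auto
    also have "\<dots> \<approx> \<epsilon> \<bullet> \<gamma> \<bullet> (W x1 \<rhd> s1 \<lhd> W y1)"
      by (rule vcomp_assoc[OF trans_on_step[OF reduction_le r1 s1] trans_on_reductions[OF \<gamma>] t\<epsilon>])
    also have "\<dots> \<approx> \<epsilon> \<bullet> \<delta> \<bullet> (W x2 \<rhd> s2 \<lhd> W y2)"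
      by (rule vcomp_cong[OF nat_eq_refl eq])
    also have "\<dots> \<approx> (\<epsilon> \<bullet> \<delta>) \<bullet> (W x2 \<rhd> s2 \<lhd> W y2)"
      by (rule nat_eq_sym,
          rule vcomp_assoc[OF trans_on_step[OF reduction_le r2 s2] trans_on_reductions[OF \<delta>] t\<epsilon>])
    also have "\<dots> \<approx> \<beta>' \<bullet> (W x2 \<rhd> s2 \<lhd> W y2)"
      using less.IH[OF _ composite_vcomp[OF reduction_le \<delta> \<epsilon>] \<beta>'] reduction_less[OF r2] u2
      by (intro vcomp_cong[OF _ nat_eq_refl]) auto
    also have "\<dots> \<approx> \<beta>"
      by (rule nat_eq_sym[OF \<beta>])
    finally show ?thesis .
  qed
qed

section \<open>Units and coherence\<close>

lemma trans_on_unit: "p \<in> I \<Longrightarrow> set x \<subseteq> I \<Longrightarrow> set y \<subseteq> I \<Longrightarrow>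
    trans_on (x @ y) (x @ [p] @ y) (W x \<rhd> unit (T p) \<lhd> W y)"
  using trans_on_whisker[OF trans_on_generator[OF generator.unit], of p x y] by simp

text \<open>Replaces the two factors applied first in a threefold composite by the other side of a
  commuting square.\<close>

lemma exchange_left:
  assumes "trans_on u v \<tau>" "trans_on v v' \<sigma>" "trans_on v' w \<alpha>"
    and "trans_on u u' \<sigma>'" "trans_on u' v' \<tau>'" and eq: "\<sigma> \<bullet> \<tau> \<approx> \<tau>' \<bullet> \<sigma>'"
  shows "(\<alpha> \<bullet> \<sigma>) \<bullet> \<tau> \<approx> (\<alpha> \<bullet> \<tau>') \<bullet> \<sigma>'"
proof -
  have "(\<alpha> \<bullet> \<sigma>) \<bullet> \<tau> \<approx> \<alpha> \<bullet> \<sigma> \<bullet> \<tau>"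
    by (rule vcomp_assoc[OF assms(1-3)])
  also have "\<dots> \<approx> \<alpha> \<bullet> \<tau>' \<bullet> \<sigma>'"
    by (rule vcomp_cong[OF nat_eq_refl eq])
  also have "\<dots> \<approx> (\<alpha> \<bullet> \<tau>') \<bullet> \<sigma>'"
    by (rule nat_eq_sym[OF vcomp_assoc[OF assms(4,5,3)]])
  finally show ?thesis .
qed

lemma swap_unit_triangles:
  assumes "p \<in> I" "q \<in> I" "q < p"
  shows "lam p q \<bullet> (unit (T p) \<lhd> endo (T q)) \<approx> endo (T q) \<rhd> unit (T p)"
    and "lam p q \<bullet> (endo (T p) \<rhd> unit (T q)) \<approx> unit (T q) \<lhd> endo (T p)"
  using law[of p q] assms by (simp_all add: distributive_law_def)

text \<open>The word with the new p has a redex; compare the redex with the place of insertion. Away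
  from p, the move and the unit commute. A swap involving p carries the unit past its neighbour by a
  unit axiom of the distributive law, and a multiplication involving p cancels it by a unit law of
  the monad. The induction is on the word after insertion.\<close>

lemma unit_absorption:
  assumes w: "sorted_wrt (<) w" and "p \<in> set (x @ y)"
    and "composite reduction (x @ [p] @ y) w \<alpha>" "composite reduction (x @ y) w \<beta>"
  shows "\<alpha> \<bullet> (W x \<rhd> unit (T p) \<lhd> W y) \<approx> \<beta>"
  using wf_lenlex[OF wf_less_than] assms(2-)
proof (induction "x @ [p] @ y" arbitrary: x y \<alpha> \<beta> rule: wf_induct_rule)
  case less
  note \<alpha> = less.prems(2) and \<beta> = less.prems(3)
  have sets: "set (x @ [p] @ y) = set w" "set w \<subseteq> I"
    using composite_reduction_set[OF \<alpha>] trans_on_set[OF trans_on_reductions[OF \<alpha>]] by auto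
  then have I: "p \<in> I" "set x \<subseteq> I" "set y \<subseteq> I"
    by auto
  \<comment> \<open>After the insertion the letter p occurs at least twice, so the word is
    reducible.\<close>
  have "\<not> sorted_wrt (<) (x @ [p] @ y)"
    using less.prems(1) by (auto simp: sorted_wrt_append)
  then obtain x' b y' v s where eq: "x @ [p] @ y = x' @ b @ y'" and r: "reduction b v s"
    using obtain_reduction sets by metis
  obtain a c where b: "b = [a, c]"
    using reduction_pair[OF r] by blast
  have xyv: "set x' \<subseteq> I" "set y' \<subseteq> I" "set v \<subseteq> I" "set (x' @ v @ y') = set w"
    "a \<in> I" "c \<in> I"
    using sets(1)[unfolded eq] sets(2) reduction_set[OF r] b by auto
  have set_b: "set b = {a, c}" "set v = {a, c}"
    using b reduction_set[OF r] by auto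
  obtain \<alpha>' where \<alpha>': "composite reduction (x' @ v @ y') w \<alpha>'"
    using reductions_exist[OF xyv(4) w sets(2)] by blast
  note step = reduction_step_composite[OF r xyv(1,2)]
  let ?\<sigma> = "W x' \<rhd> s \<lhd> W y'" and ?\<tau> = "W x \<rhd> unit (T p) \<lhd> W y"
  \<comment> \<open>By uniqueness of reductions, \<alpha> may be taken to begin with the chosen
    redex.\<close>
  have \<alpha>_eq: "\<alpha> \<approx> \<alpha>' \<bullet> ?\<sigma>"
    using reductions_unique[OF w \<alpha>] composite_vcomp[OF reduction_le step \<alpha>'] eq by simp
  note t\<tau> = trans_on_unit[OF I] and t\<alpha>' = trans_on_reductions[OF \<alpha>']
  have t\<sigma>: "trans_on (x @ [p] @ y) (x' @ v @ y') ?\<sigma>"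
    using trans_on_reductions[OF step] eq by simp
  have smaller: "(x' @ v @ y', x @ [p] @ y) \<in> lenlex less_than"
    using reduction_less[OF r] eq by simp
  have \<alpha>\<tau>: "\<alpha> \<bullet> ?\<tau> \<approx> (\<alpha>' \<bullet> ?\<sigma>) \<bullet> ?\<tau>"
    by (rule vcomp_cong[OF \<alpha>_eq nat_eq_refl])
  have t_unit: "trans_on [] [p] (unit (T p))"
    using trans_on_unit[OF I(1), of "[]" "[]"] by simp
  have \<alpha>\<tau>': "\<alpha> \<bullet> ?\<tau> \<approx> \<alpha>' \<bullet> \<kappa>" if "?\<sigma> \<bullet> ?\<tau> \<approx> \<kappa>" for \<kappa>
  proof -
    have "\<alpha> \<bullet> ?\<tau> \<approx> \<alpha>' \<bullet> ?\<sigma> \<bullet> ?\<tau>"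
      by (rule nat_eq_trans[OF \<alpha>\<tau> vcomp_assoc[OF t\<tau> t\<sigma> t\<alpha>']])
    also have "\<dots> \<approx> \<alpha>' \<bullet> \<kappa>"
      by (rule vcomp_cong[OF nat_eq_refl that])
    finally show ?thesis .
  qed
  \<comment> \<open>The multiplication cancels the unit, and what remains are two reductions of the
    same word.\<close>
  have finish_id: ?case if "?\<sigma> \<bullet> ?\<tau> \<approx> id_trans (x @ y)" "x' @ v @ y' = x @ y"
  proof -
    have "\<alpha> \<bullet> ?\<tau> \<approx> \<alpha>' \<bullet> id_trans (x @ y)"
      by (rule \<alpha>\<tau>'[OF that(1)])
    also have "\<dots> \<approx> \<alpha>'"
      using vcomp_id_right[OF t\<alpha>'] that(2) by simp
    also have "\<dots> \<approx> \<beta>"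
      using reductions_unique[OF w _ \<beta>] \<alpha>' that(2) by simp
    finally show ?thesis .
  qed
  \<comment> \<open>After a swap involving p there is again a single insertion of p into the word
    xy, now at another place and with a smaller result.\<close>
  have finish_unit: ?case if "?\<sigma> \<bullet> ?\<tau> \<approx> W x2 \<rhd> unit (T p) \<lhd> W y2"
    "x' @ v @ y' = x2 @ [p] @ y2" "x2 @ y2 = x @ y" for x2 y2
  proof -
    have "\<alpha>' \<bullet> (W x2 \<rhd> unit (T p) \<lhd> W y2) \<approx> \<beta>"
      using less.hyps[of x2 y2 \<alpha>' \<beta>] smaller \<alpha>' \<beta> less.prems(1) that(2,3) by simp
    then show ?thesis
      using \<alpha>\<tau>'[OF that(1)] nat_eq_trans by blast
  qed
  \<comment> \<open>The redex avoids the inserted p, so it can be contracted before the insertion;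
    the induction hypothesis then absorbs the unit in the shrunken word.\<close>
  have finish_commute: ?case if eq\<sigma>: "?\<sigma> \<bullet> ?\<tau> \<approx> (W x2 \<rhd> unit (T p) \<lhd> W y2) \<bullet> \<sigma>'"
    and \<sigma>': "composite reduction (x @ y) (x2 @ y2) \<sigma>'" and p: "p \<in> set (x2 @ y2)"
    and eq2: "x' @ v @ y' = x2 @ [p] @ y2" for x2 y2 \<sigma>'
  proof -
    have "set (x2 @ y2) = set w"
      using composite_reduction_set[OF \<sigma>'] composite_reduction_set[OF \<beta>] by simp
    then obtain \<beta>' where \<beta>': "composite reduction (x2 @ y2) w \<beta>'"
      using reductions_exist w sets(2) by blast
    let ?\<tau>' = "W x2 \<rhd> unit (T p) \<lhd> W y2"
    have \<tau>': "trans_on (x2 @ y2) (x' @ v @ y') ?\<tau>'"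
      using trans_on_unit[OF I(1), of x2 y2] trans_on_set[OF t\<alpha>'] eq2 by simp
    have "(\<alpha>' \<bullet> ?\<sigma>) \<bullet> ?\<tau> \<approx> (\<alpha>' \<bullet> ?\<tau>') \<bullet> \<sigma>'"
      by (rule exchange_left[OF t\<tau> t\<sigma> t\<alpha>' trans_on_reductions[OF \<sigma>'] \<tau>' eq\<sigma>])
    also have "\<dots> \<approx> \<beta>' \<bullet> \<sigma>'"
      using less.hyps[of x2 y2 \<alpha>' \<beta>'] smaller \<alpha>' \<beta>' p eq2
      by (intro vcomp_cong[OF _ nat_eq_refl]) simp
    also have "\<dots> \<approx> \<beta>"
      by (rule reductions_unique[OF w composite_vcomp[OF reduction_le \<sigma>' \<beta>'] \<beta>])
    finally show ?thesis
      using \<alpha>\<tau> nat_eq_trans by blast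
  qed
  (* the position of the inserted p relative to the redex b = [a, c] *)
  from adjacent_pair_cases[OF eq[unfolded b]] show ?case
  proof cases
    case (1 t)
    have t: "set t \<subseteq> I"
      using I 1 by auto
    have eq': "x' @ v @ y' = (x' @ v @ t) @ [p] @ y"
      using 1 by simp
    let ?\<tau>' = "W (x' @ v @ t) \<rhd> unit (T p) \<lhd> W y" and ?\<sigma>' = "W x' \<rhd> s \<lhd> W (t @ y)"
    have "?\<sigma> \<bullet> ?\<tau> \<approx> ?\<tau>' \<bullet> ?\<sigma>'"
      using interchange_whisker[OF trans_on_reduction[OF r] t_unit xyv(1) t I(3)] 1 b by simp
    moreover have "composite reduction (x @ y) ((x' @ v @ t) @ y) ?\<sigma>'"
      using reduction_step_composite[OF r xyv(1), of "t @ y"] t I b 1 by simp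
    moreover have "p \<in> set ((x' @ v @ t) @ y)"
      using less.prems(1) 1 set_b by auto
    ultimately show ?thesis
      using finish_commute eq' by blast
  next
    case 2
    have eq': "b = [a, p]" "x' @ [a] @ y = x @ y" "?\<tau> = W x' \<rhd> (endo (T a) \<rhd> unit (T p)) \<lhd> W y'"
      using 2 b by (simp_all add: word_endo_append whisker_left_comp whisker_left_right)
    have t\<tau>0: "trans_on [a] b (endo (T a) \<rhd> unit (T p))"
      using trans_on_unit[of p "[a]" "[]"] eq'(1) I(1) xyv(5) by simp
    note whisker = whisker_vcomp_eq[OF _ t\<tau>0 trans_on_reduction[OF r] xyv(1,2)]
    from r show ?thesis
    proof cases
      case (swap a' p')
      then have eq: "v = [p, a]" "s = lam a p" "p < a"
        using eq'(1) by auto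
      have "?\<sigma> \<bullet> ?\<tau> \<approx> W x' \<rhd> (unit (T p) \<lhd> endo (T a)) \<lhd> W y'"
        unfolding eq'(3)
        by (rule whisker) (use swap_unit_triangles(2)[OF xyv(5) I(1) eq(3)] eq(2) in simp)
      then have "?\<sigma> \<bullet> ?\<tau> \<approx> W x' \<rhd> unit (T p) \<lhd> W ([a] @ y)"
        using 2 by (simp add: whisker_right_comp)
      then show ?thesis
        using finish_unit[of x' "[a] @ y"] eq'(2) eq 2 by simp
    next
      case (mult p')
      then have eq: "a = p" "v = [p]" "s = mult (T p)"
        using eq'(1) by auto
      have "s \<bullet> (endo (T a) \<rhd> unit (T p)) \<approx> id_trans [p]"
        using monad[OF I(1)] eq by (simp add: is_monad_def)
      then have "?\<sigma> \<bullet> ?\<tau> \<approx> id_trans (x' @ [p] @ y')"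
        unfolding eq'(3) by (rule nat_eq_trans[OF whisker whisker_id]) (use I xyv in simp_all)
      then show ?thesis
        using finish_id eq'(2) eq 2 by simp
    qed
  next
    case 3
    have eq': "b = [p, c]" "x' @ [c] @ y' = x @ y" "?\<tau> = W x' \<rhd> (unit (T p) \<lhd> endo (T c)) \<lhd> W y'"
      using 3 b by (simp_all add: whisker_right_comp)
    have t\<tau>0: "trans_on [c] b (unit (T p) \<lhd> endo (T c))"
      using trans_on_unit[of p "[]" "[c]"] eq'(1) I(1) xyv(6) by simp
    note whisker = whisker_vcomp_eq[OF _ t\<tau>0 trans_on_reduction[OF r] xyv(1,2)]
    from r show ?thesis
    proof cases
      case (swap p' c')
      then have eq: "v = [c, p]" "s = lam p c" "c < p"
        using eq'(1) by auto
      have "?\<sigma> \<bullet> ?\<tau> \<approx> W x' \<rhd> (endo (T c) \<rhd> unit (T p)) \<lhd> W y'"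
        unfolding eq'(3)
        by (rule whisker) (use swap_unit_triangles(1)[OF I(1) xyv(6) eq(3)] eq(2) in simp)
      then have "?\<sigma> \<bullet> ?\<tau> \<approx> W (x' @ [c]) \<rhd> unit (T p) \<lhd> W y'"
        by (simp add: word_endo_append whisker_left_comp whisker_left_right)
      then show ?thesis
        using finish_unit[of "x' @ [c]" y'] eq'(2) eq by simp
    next
      case (mult p')
      then have eq: "c = p" "v = [p]" "s = mult (T p)"
        using eq'(1) by auto
      have "s \<bullet> (unit (T p) \<lhd> endo (T c)) \<approx> id_trans [p]"
        using monad[OF I(1)] eq by (simp add: is_monad_def)
      then have "?\<sigma> \<bullet> ?\<tau> \<approx> id_trans (x' @ [p] @ y')"
        unfolding eq'(3) by (rule nat_eq_trans[OF whisker whisker_id]) (use I xyv in simp_all)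
      then show ?thesis
        using finish_id eq'(2) eq by simp
    qed
  next
    case (4 t)
    have t: "set t \<subseteq> I"
      using I 4 by auto
    have eq': "x' @ v @ y' = x @ [p] @ (t @ v @ y')"
      using 4 by simp
    let ?\<tau>' = "W x \<rhd> unit (T p) \<lhd> W (t @ v @ y')" and ?\<sigma>' = "W (x @ t) \<rhd> s \<lhd> W y'"
    have "?\<sigma> \<bullet> ?\<tau> \<approx> ?\<tau>' \<bullet> ?\<sigma>'"
      using nat_eq_sym[OF interchange_whisker[OF t_unit trans_on_reduction[OF r] I(2) t xyv(2)]] 4 b
      by simp
    moreover have "composite reduction (x @ y) (x @ t @ v @ y') ?\<sigma>'"
      using reduction_step_composite[OF r _ xyv(2), of "x @ t"] t I b 4 by simp
    moreover have "p \<in> set (x @ t @ v @ y')"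
      using less.prems(1) 4 set_b by auto
    ultimately show ?thesis
      using finish_commute eq' by blast
  qed
qed

section \<open>Inserting whole words of units, and coherence\<close>

lemma composite_word_unit: "set v \<subseteq> I \<Longrightarrow> composite generator [] v (word_unit C T v)"
proof (induction v)
  case Nil
  then show ?case
    using composite.refl[of "[]" "word_unit C T []"] by simp
next
  case (Cons p v)
  have "composite generator v (p # v) (unit (T p) \<lhd> W v)"
    using composite_right[OF order_refl _ composite_single[OF order_refl generator.unit[of p]], of v]
      Cons.prems by simp
  then show ?case
    using composite_vcomp[OF order_refl Cons.IH] Cons.prems by (simp add: hcomp_def)
qed

text \<open>The leftmost letter of v is inserted last, so it is absorbed first; the remaining
  letters follow by induction.\<close>

lemma word_unit_absorption:
  assumes w: "sorted_wrt (<) w" and "set v \<subseteq> set u"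
    and "composite reduction (v @ u) w \<alpha>" "composite reduction u w \<beta>"
  shows "\<alpha> \<bullet> (word_unit C T v \<lhd> W u) \<approx> \<beta>"
  using assms(2,3)
proof (induction v arbitrary: \<alpha>)
  case Nil
  have "\<alpha> \<bullet> id_trans u \<approx> \<alpha>"
    using Nil.prems by (intro vcomp_id_right[OF trans_on_reductions]) auto
  also have "\<alpha> \<approx> \<beta>"
    using reductions_unique[OF w] Nil.prems assms(4) by simp
  finally show ?case
    by (simp add: whisker_right_def)
next
  case (Cons p v)
  have sets: "set (v @ u) = set w" "set w \<subseteq> I"
    using Cons.prems composite_reduction_set[OF assms(4)] trans_on_set[OF trans_on_reductions[OF assms(4)]]
    by auto
  then have pv: "p \<in> I" "set v \<subseteq> I" "set u \<subseteq> I"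
    using Cons.prems by auto
  obtain \<alpha>' where \<alpha>': "composite reduction (v @ u) w \<alpha>'"
    using reductions_exist[OF sets(1) w sets(2)] by blast
  let ?\<eta> = "word_unit C T v \<lhd> W u"
  have \<eta>: "trans_on u (v @ u) ?\<eta>"
    using trans_on_composite[OF order_refl composite_right[OF order_refl pv(3) composite_word_unit[OF pv(2)]]]
    by simp
  have p: "trans_on (v @ u) (p # v @ u) (unit (T p) \<lhd> W (v @ u))"
    using trans_on_unit[OF pv(1), of "[]" "v @ u"] pv by simp
  have \<alpha>: "trans_on (p # v @ u) w \<alpha>"
    using trans_on_reductions[OF Cons.prems(2)] by simp
  \<comment> \<open>An equality of families of components: a horizontal composite taken with
    \<open>id_endo\<close> is already an ordinary composite.\<close>
  have unit_eq: "\<alpha> \<bullet> (word_unit C T (p # v) \<lhd> W u) = \<alpha> \<bullet> (unit (T p) \<lhd> W (v @ u)) \<bullet> ?\<eta>"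
    by (simp add: hcomp_def vcomp_def whisker_right_def word_endo_append)
  have "\<alpha> \<bullet> (unit (T p) \<lhd> W (v @ u)) \<bullet> ?\<eta> \<approx> (\<alpha> \<bullet> (unit (T p) \<lhd> W (v @ u))) \<bullet> ?\<eta>"
    by (rule nat_eq_sym[OF vcomp_assoc[OF \<eta> p \<alpha>]])
  also have "\<dots> \<approx> \<alpha>' \<bullet> ?\<eta>"
    using unit_absorption[OF w, of p "[]" "v @ u" \<alpha> \<alpha>'] Cons.prems \<alpha>'
    by (intro vcomp_cong[OF _ nat_eq_refl]) auto
  also have "\<dots> \<approx> \<beta>"
    using Cons.IH[OF _ \<alpha>'] Cons.prems by simp
  finally show ?case
    unfolding unit_eq .
qed

text \<open>Induction along the composite. By interchange its first move can be made after the
  insertion of w, on the part to the right of w. There the normalization absorbs it: a reduction by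
  uniqueness, a unit by \<open>unit_absorption\<close>.\<close>

lemma composite_normal_form:
  assumes w: "sorted_wrt (<) w" and "composite generator u w \<alpha>" "composite reduction (w @ u) w \<rho>"
  shows "\<alpha> \<approx> \<rho> \<bullet> (word_unit C T w \<lhd> W u)"
  using assms(2,1,3)
proof (induction arbitrary: \<rho> rule: composite.induct)
  case (refl w \<alpha>)
  \<comment> \<open>The identity of w is itself a reduction to normal form, so absorbing the units
    leaves the identity.\<close>
  have "\<rho> \<bullet> (word_unit C T w \<lhd> W w) \<approx> id_trans w"
    using refl by (intro word_unit_absorption[of w w w]) (auto intro: composite.refl)
  then show ?case
    using refl.hyps(2) nat_eq_sym nat_eq_trans by blast
next
  case (step u v s x y w \<alpha> \<beta>)
  note sets = composite_generator_set[OF step.hyps(4)] generator_set[OF step.hyps(1)]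
  have w: "set w \<subseteq> I"
    using composite_set step.hyps(4) by blast
  have "set (w @ x @ v @ y) = set w"
    using sets by auto
  then obtain \<rho>' where \<rho>': "composite reduction (w @ x @ v @ y) w \<rho>'"
    using reductions_exist step.prems(1) w by blast
  let ?\<sigma> = "W x \<rhd> s \<lhd> W y"
  have \<sigma>: "trans_on (x @ u @ y) (x @ v @ y) ?\<sigma>"
    using trans_on_step[OF order_refl step.hyps(1-3)] .
  have \<eta>: "trans_on [] w (word_unit C T w)"
    by (rule trans_on_composite[OF order_refl composite_word_unit[OF w]])
  have \<eta>': "trans_on z (w @ z) (word_unit C T w \<lhd> W z)" if "set z \<subseteq> I" for z
    using trans_on_whisker[OF \<eta>, of "[]" z] that by simp
  have w\<sigma>: "trans_on (w @ x @ u @ y) (w @ x @ v @ y) (W w \<rhd> ?\<sigma>)"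
    using trans_on_whisker[OF \<sigma> w, of "[]"] by simp
  have \<rho>_eq: "\<rho>' \<bullet> (W w \<rhd> ?\<sigma>) \<approx> \<rho>"
    using step.hyps(1)
  proof cases
    case reduction
    then have "composite reduction (w @ x @ u @ y) (w @ x @ v @ y) (W w \<rhd> ?\<sigma>)"
      using composite_left[OF reduction_le w reduction_step_composite[OF _ step.hyps(2,3)]] by blast
    then show ?thesis
      using reductions_unique[OF step.prems(1) composite_vcomp[OF reduction_le _ \<rho>'] step.prems(2)] by blast
  next
    case (unit p)
    \<comment> \<open>Later moves never lose a letter, so the inserted p occurs in w and its unit
      can be absorbed.\<close>
    have "\<rho>' \<bullet> (W (w @ x) \<rhd> unit (T p) \<lhd> W y) \<approx> \<rho>"
      using unit sets \<rho>' step.prems by (intro unit_absorption[of w]) auto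
    then show ?thesis
      using unit by (simp add: word_endo_append whisker_left_comp)
  qed
  have "\<beta> \<approx> \<alpha> \<bullet> ?\<sigma>"
    by (rule step.hyps(5))
  also have "\<dots> \<approx> (\<rho>' \<bullet> (word_unit C T w \<lhd> W (x @ v @ y))) \<bullet> ?\<sigma>"
    by (rule vcomp_cong[OF step.IH[OF step.prems(1) \<rho>'] nat_eq_refl])
  also have "\<dots> \<approx> (\<rho>' \<bullet> (W w \<rhd> ?\<sigma>)) \<bullet> (word_unit C T w \<lhd> W (x @ u @ y))"
    using interchange[OF \<eta> \<sigma>]
    by (intro exchange_left[OF \<sigma> \<eta>' trans_on_reductions[OF \<rho>'] \<eta>' w\<sigma>])
      (use trans_on_set[OF \<sigma>] in auto)
  also have "\<dots> \<approx> \<rho> \<bullet> (word_unit C T w \<lhd> W (x @ u @ y))"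
    by (rule vcomp_cong[OF \<rho>_eq nat_eq_refl])
  finally show ?case .
qed

text \<open>A single normalization \<rho> serves both composites, and the expression in
  \<open>composite_normal_form\<close> does not mention them.\<close>

theorem coherence:
  assumes "sorted_wrt (<) w" and \<alpha>: "composite generator u w \<alpha>" and "composite generator u w \<beta>"
  shows "\<alpha> \<approx> \<beta>"
proof -
  have "set (w @ u) = set w"
    using composite_generator_set[OF \<alpha>] by auto
  then obtain \<rho> where "composite reduction (w @ u) w \<rho>"
    using reductions_exist assms(1) composite_set[OF \<alpha>] by blast
  then show ?thesis
    using composite_normal_form[OF assms(1)] assms(2,3) nat_eq_sym nat_eq_trans by blast
qed

section \<open>Canonical monads\<close>

lemma composite_swaps:
  "swap_composite C T lam u w \<alpha> \<Longrightarrow> set w \<subseteq> I \<Longrightarrow> composite generator u w \<alpha>"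
proof (induction rule: swap_composite.induct)
  case (refl w)
  then show ?case
    by (auto intro: composite.refl)
next
  case (step p q u v w \<alpha>)
  have \<alpha>: "composite generator (u @ [q, p] @ v) w \<alpha>"
    by (rule step.IH[OF step.prems])
  then have I: "set u \<subseteq> I" "set v \<subseteq> I" "p \<in> I" "q \<in> I"
    using composite_set by fastforce+
  have "composite reduction (u @ [p, q] @ v) (u @ [q, p] @ v) (W u \<rhd> lam p q \<lhd> W v)"
    by (rule reduction_step_composite[OF swap[OF I(3,4) step.hyps(1)] I(1,2)])
  then show ?case
    by (rule composite_vcomp[OF order_refl composite_mono[OF _ reduction_le] \<alpha>])
qed

lemmas composite_left' = composite_left[OF order_refl]
lemmas composite_right' = composite_right[OF order_refl]
lemmas composite_vcomp' = composite_vcomp[OF order_refl]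
lemmas composite_generator = composite_single[OF order_refl]

lemma composite_word_mult: "set w \<subseteq> I \<Longrightarrow> composite generator (double w) w (word_mult C T w)"
proof (induction w)
  case Nil
  then show ?case
    using composite.refl[of "[]" "word_mult C T []"] by simp
next
  case (Cons p w)
  then have "p \<in> I" "set w \<subseteq> I" and w: "composite generator (double w) w (word_mult C T w)"
    by auto
  then have "composite generator ([p, p] @ w) ([p] @ w) (mult (T p) \<lhd> W w)"
    by (intro composite_right' composite_generator generator.reduction reduction.mult)
  moreover have "composite generator ([p, p] @ double w) ([p, p] @ w)
      (W [p, p] \<rhd> word_mult C T w)"
    using w \<open>p \<in> I\<close> by (intro composite_left') auto
  ultimately show ?case
    using composite_vcomp' by (fastforce simp: hcomp_def)
qed

text \<open>The invariant shared by all iterated structures, whatever the bracketing. The functor is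
  the word on the nose, so \<open>coherence\<close> applies directly to equations between the
  structure maps; for strictly increasing w the monad axioms follow.\<close>

definition composite_structure where
  "composite_structure w M \<longleftrightarrow> endo M = W w \<and>
    composite generator [] w (unit M) \<and> composite generator (w @ w) w (mult M)"

lemma composite_structure_single: "p \<in> I \<Longrightarrow> composite_structure [p] (T p)"
  by (auto simp: composite_structure_def
      intro: composite_generator generator.intros reduction.mult)

text \<open>The induced multiplication first applies the law in the middle, then the two
  multiplications; whiskered, each of these factors is a composite of moves between words.\<close>

lemma composite_structure_induced:
  assumes M: "composite_structure v M" and N: "composite_structure w N"
    and l: "composite generator (w @ v) (v @ w) l"
  shows "composite_structure (v @ w) (induced_monad C N M l)"
proof -
  have I: "set v \<subseteq> I" "set w \<subseteq> I"
    using composite_set[OF l] by auto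
  note M' = M[unfolded composite_structure_def] and N' = N[unfolded composite_structure_def]
  have "composite generator ([] @ w) (v @ w) (unit M \<lhd> W w)"
    using M' I by (intro composite_right') auto
  then have 1: "composite generator [] (v @ w) ((unit M \<lhd> W w) \<bullet> unit N)"
    using composite_vcomp' N' by fastforce
  have "composite generator (v @ (w @ v) @ w) (v @ (v @ w) @ w) (W v \<rhd> l \<lhd> W w)"
    by (rule composite_whisker[OF order_refl I l])
  moreover have "composite generator ((v @ v) @ w @ w) ((v @ v) @ w) (W (v @ v) \<rhd> mult N)"
    using N' I by (intro composite_left') auto
  moreover have "composite generator ((v @ v) @ w) (v @ w) (mult M \<lhd> W w)"
    using M' I by (intro composite_right') auto
  ultimately have 2: "composite generator ((v @ w) @ v @ w) (v @ w)
      (((mult M \<lhd> W w) \<bullet> (W (v @ v) \<rhd> mult N)) \<bullet> (W v \<rhd> l \<lhd> W w))"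
    using composite_vcomp'[OF _ composite_vcomp'] by simp
  show ?thesis
    using 1 2 M' N' by (simp add: composite_structure_def induced_monad_def hcomp_def word_endo_append)
qed

lemma composite_structure_canonical:
  "canonical_monad C T lam a b M \<Longrightarrow> {a..b} \<subseteq> I \<Longrightarrow> a \<le> b \<and> composite_structure (block a b) M"
proof (induction rule: canonical_monad.induct)
  case (single a)
  then show ?case
    by (simp add: composite_structure_single)
next
  case (split a j b M N l)
  have eq: "block a j @ block (j + 1) b = block a b"
    using split.hyps(1,2) by (intro block_append) auto
  have "composite generator (block (j + 1) b @ block a j) (block a j @ block (j + 1) b) l"
    using split.hyps split.prems by (intro composite_swaps) (auto simp: obvious_composite_def)
  moreover have "{a..j} \<subseteq> I" "{j + 1..b} \<subseteq> I"
    using split.hyps(1,2) split.prems by auto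
  then have "composite_structure (block a j) M" "composite_structure (block (j + 1) b) N"
    using split.IH by blast+
  ultimately have "composite_structure (block a j @ block (j + 1) b) (induced_monad C N M l)"
    by (intro composite_structure_induced)
  then show ?case
    using split.hyps(1,2) unfolding eq by simp
qed

text \<open>Both sides of every axiom are composites from the same word to the strictly increasing
  word w, so they agree by coherence.\<close>

lemma is_monad_composite_structure:
  assumes M: "composite_structure w M" and w: "sorted_wrt (<) w"
  shows "is_monad C M"
proof -
  have e: "endo M = W w" and u: "composite generator [] w (unit M)"
    and m: "composite generator (w @ w) w (mult M)"
    using M by (auto simp: composite_structure_def)
  have I: "set w \<subseteq> I"
    using composite_set[OF u] by simp
  note nat = trans_on_composite[OF order_refl]
  note coh = coherence[OF w]
  have id: "composite generator w w (id_trans w)"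
    using I by (auto intro: composite.refl)
  have uw: "composite generator w (w @ w) (unit M \<lhd> W w)" and wu: "composite generator w (w @ w) (W w \<rhd> unit M)"
    using composite_right'[OF I u] composite_left'[OF I u] by auto
  have mw: "composite generator (w @ w @ w) (w @ w) (mult M \<lhd> W w)"
    and wm: "composite generator (w @ w @ w) (w @ w) (W w \<rhd> mult M)"
    using composite_right'[OF I m] composite_left'[OF I m] by auto
  show ?thesis
    unfolding is_monad_def e
    using endofunctor_word[OF I] nat[OF u] nat[OF m]
      coh[OF composite_vcomp'[OF uw m] id] coh[OF composite_vcomp'[OF wu m] id]
      coh[OF composite_vcomp'[OF mw m] composite_vcomp'[OF wm m]]
    by (simp add: trans_on_def word_endo_append)
qed

text \<open>The four axioms compare composites ending in the word vw, which is strictly increasing,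
  so coherence proves each of them.\<close>

lemma distributive_law_composite_structure:
  assumes M: "composite_structure v M" and N: "composite_structure w N"
    and l: "composite generator (w @ v) (v @ w) l" and vw: "sorted_wrt (<) (v @ w)"
  shows "distributive_law C N M l"
proof -
  have sorted: "sorted_wrt (<) v" "sorted_wrt (<) w"
    using vw by (auto simp: sorted_wrt_append)
  have I: "set v \<subseteq> I" "set w \<subseteq> I"
    using composite_set[OF l] by auto
  have e: "endo M = W v" "endo N = W w"
    and u: "composite generator [] v (unit M)" "composite generator [] w (unit N)"
    and m: "composite generator (v @ v) v (mult M)" "composite generator (w @ w) w (mult N)"
    using M N by (auto simp: composite_structure_def)
  note coh = coherence[OF vw] and left = composite_left' and right = composite_right'
    and comp = composite_vcomp'
  have "l \<bullet> (unit N \<lhd> W v) \<approx> W v \<rhd> unit N"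
    using coh[OF comp[OF right[OF I(1) u(2), simplified] l] left[OF I(1) u(2), simplified]] .
  moreover have "l \<bullet> (W w \<rhd> unit M) \<approx> unit M \<lhd> W w"
    using coh[OF comp[OF left[OF I(2) u(1), simplified] l] right[OF I(2) u(1), simplified]] .
  moreover have "l \<bullet> (mult N \<lhd> W v) \<approx> (W v \<rhd> mult N) \<bullet> (l \<lhd> W w) \<bullet> (W w \<rhd> l)"
    using coh[OF comp[OF right[OF I(1) m(2), simplified] l]
        comp[OF comp[OF left[OF I(2) l] right[OF I(2) l, simplified]] left[OF I(1) m(2)]]] .
  moreover have "l \<bullet> (W w \<rhd> mult M) \<approx> (mult M \<lhd> W w) \<bullet> (W v \<rhd> l) \<bullet> (l \<lhd> W v)"
    using coh[OF comp[OF left[OF I(2) m(1)] l]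
        comp[OF comp[OF right[OF I(1) l, simplified] left[OF I(1) l]] right[OF I(2) m(1), simplified]]] .
  moreover have "natural C (W w \<odot> W v) (W v \<odot> W w) l"
    using trans_on_composite[OF order_refl l] by (simp add: trans_on_def word_endo_append)
  ultimately show ?thesis
    using is_monad_composite_structure[OF M sorted(1)] is_monad_composite_structure[OF N sorted(2)]
    by (simp add: distributive_law_def e)
qed

text \<open>Source and target words of the structure maps depend only on w, so coherence identifies
  the units and the multiplications. This gives independence of bracketing, of the order of swaps
  and of the splitting index i.\<close>

lemma monad_eq_composite_structure:
  assumes "composite_structure w M" "composite_structure w N" "sorted_wrt (<) w"
  shows "monad_eq C M N"
  using assms coherence by (auto simp: composite_structure_def monad_eq_def endo_eq_def)

lemma canonical_form_composite_structure:
  assumes M: "composite_structure (block a b) M"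
  shows "canonical_form C T lam a b M"
proof -
  let ?w = "block a b"
  have w: "sorted_wrt (<) ?w"
    by (simp del: upt_Suc)
  have I: "set ?w \<subseteq> I"
    using M composite_set unfolding composite_structure_def by blast
  \<comment> \<open>Sorting ww brings the two copies of each letter together, so the required swaps
    exist.\<close>
  have "sort (?w @ ?w) = double ?w"
    by (rule properties_for_sort) (simp_all add: mset_double sorted_double del: upt_Suc)
  then have "\<exists>s. swap_composite C T lam (?w @ ?w) (double ?w) s"
    using swap_composite_sort by metis
  moreover have "mult M \<approx> word_mult C T ?w \<bullet> s"
    if "swap_composite C T lam (?w @ ?w) (double ?w) s" for s
    using coherence[OF w, of "?w @ ?w" "mult M" "word_mult C T ?w \<bullet> s"] M
      composite_vcomp'[OF composite_swaps[OF that] composite_word_mult[OF I]] I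
    by (auto simp: composite_structure_def simp del: upt_Suc)
  moreover have "unit M \<approx> word_unit C T ?w"
    using coherence[OF w] M composite_word_unit[OF I] by (auto simp: composite_structure_def)
  ultimately show ?thesis
    using M by (simp add: canonical_form_def endo_eq_def composite_structure_def del: upt_Suc)
qed

end

theorem theorem2p1:
  fixes C :: "('o, 'm) cat"
    and T :: "nat \<Rightarrow> ('o, 'm) monad"
    and lam :: "nat \<Rightarrow> nat \<Rightarrow> 'o \<Rightarrow> 'm"
    and n :: nat
  assumes n: "n \<ge> 3"
    and cat: "category C"
    and monads: "\<And>i. 1 \<le> i \<Longrightarrow> i \<le> n \<Longrightarrow> is_monad C (T i)"
    and laws: "\<And>i j. 1 \<le> j \<Longrightarrow> j < i \<Longrightarrow> i \<le> n \<Longrightarrow> distributive_law C (T i) (T j) (lam i j)"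
    and yb: "\<And>i j k. 1 \<le> k \<Longrightarrow> k < j \<Longrightarrow> j < i \<Longrightarrow> i \<le> n \<Longrightarrow> yang_baxter C T lam i j k"
  shows
    "(\<forall>i. 1 \<le> i \<and> i < n \<longrightarrow>
        (\<exists>M. canonical_monad C T lam 1 i M) \<and>
        (\<exists>N. canonical_monad C T lam (i + 1) n N) \<and>
        (\<exists>l. obvious_composite C T lam 1 i n l) \<and>
        (\<forall>M M'. canonical_monad C T lam 1 i M \<and> canonical_monad C T lam 1 i M' \<longrightarrow>
          monad_eq C M M') \<and>
        (\<forall>N N'. canonical_monad C T lam (i + 1) n N \<and> canonical_monad C T lam (i + 1) n N' \<longrightarrow>
          monad_eq C N N') \<and>
        (\<forall>l l'. obvious_composite C T lam 1 i n l \<and> obvious_composite C T lam 1 i n l' \<longrightarrow>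
          nat_eq C l l') \<and>
        (\<forall>M N l. canonical_monad C T lam 1 i M \<and> canonical_monad C T lam (i + 1) n N \<and>
            obvious_composite C T lam 1 i n l \<longrightarrow>
          is_monad C M \<and> canonical_form C T lam 1 i M \<and>
          is_monad C N \<and> canonical_form C T lam (i + 1) n N \<and>
          distributive_law C N M l \<and>
          is_monad C (induced_monad C N M l))) \<and>
     (\<forall>i M N l i' M' N' l'.
        1 \<le> i \<and> i < n \<and> canonical_monad C T lam 1 i M \<and> canonical_monad C T lam (i + 1) n N \<and>
          obvious_composite C T lam 1 i n l \<and>
        1 \<le> i' \<and> i' < n \<and> canonical_monad C T lam 1 i' M' \<and> canonical_monad C T lam (i' + 1) n N' \<and>
          obvious_composite C T lam 1 i' n l' \<longrightarrow>
        monad_eq C (induced_monad C N M l) (induced_monad C N' M' l'))"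
proof -
  interpret distributive_series C T lam "{1..n}"
    using cat monads laws yb by (auto simp: distributive_series_def distributive_series_axioms_def)
  have sorted: "sorted_wrt (<) (block a b)" for a b
    by (simp del: upt_Suc)
  \<comment> \<open>Every splitting has the same concatenated word, and this word is strictly
    increasing, as coherence requires of targets.\<close>
  have append: "block 1 i @ block (i + 1) n = block 1 n" if "1 \<le> i" "i < n" for i
    using that by (intro block_append) auto
  have law: "composite generator (block (i + 1) n @ block 1 i) (block 1 i @ block (i + 1) n) l"
    if "1 \<le> i" "i < n" "obvious_composite C T lam 1 i n l" for i l
    using that by (intro composite_swaps) (auto simp: obvious_composite_def)
  have left: "composite_structure (block 1 i) M"
    if "1 \<le> i" "i < n" "canonical_monad C T lam 1 i M" for i M
    using composite_structure_canonical[OF that(3)] that by auto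
  have right: "composite_structure (block (i + 1) n) N"
    if "1 \<le> i" "i < n" "canonical_monad C T lam (i + 1) n N" for i N
    using composite_structure_canonical[OF that(3)] that by auto
  \<comment> \<open>The underlying word does not depend on i, which makes the structures for
    different i comparable.\<close>
  have whole: "composite_structure (block 1 n) (induced_monad C N M l)"
    if "1 \<le> i" "i < n" "canonical_monad C T lam 1 i M" "canonical_monad C T lam (i + 1) n N"
      "obvious_composite C T lam 1 i n l" for i M N l
    using composite_structure_induced[OF left right law] that append by metis
  have exist: "\<exists>M. canonical_monad C T lam 1 i M" "\<exists>N. canonical_monad C T lam (i + 1) n N"
    "\<exists>l. obvious_composite C T lam 1 i n l" if "1 \<le> i" "i < n" for i
    using that by (intro canonical_monad_exists obvious_composite_exists; simp)+
  have unique_law: "nat_eq C l l'" if "1 \<le> i" "i < n" "obvious_composite C T lam 1 i n l"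
    "obvious_composite C T lam 1 i n l'" for i l l'
    using coherence[OF _ law law] sorted append that by metis
  have distributive: "distributive_law C N M l"
    if "1 \<le> i" "i < n" "canonical_monad C T lam 1 i M" "canonical_monad C T lam (i + 1) n N"
      "obvious_composite C T lam 1 i n l" for i M N l
    using distributive_law_composite_structure[OF left right law] that append sorted by metis
  note equal = monad_eq_composite_structure[OF left left sorted]
    monad_eq_composite_structure[OF right right sorted]
    monad_eq_composite_structure[OF whole whole sorted]
  note forms = is_monad_composite_structure[OF left sorted] is_monad_composite_structure[OF right sorted]
    is_monad_composite_structure[OF whole sorted]
    canonical_form_composite_structure[OF left] canonical_form_composite_structure[OF right]
  show ?thesis
    by (intro conjI allI impI; elim conjE; rule exist unique_law distributive equal forms; assumption)
qed

end
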